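(* The minimum integer $k\ge 1$ such that every three-dimensional grid graph is a $k$-interval-PCG is exactly $2$.
   Context: All graphs are finite, simple, undirected, with nonempty vertex set. A weighted tree is a finite tree with strictly positive real edge weights. For a weighted tree $T$ and vertices $x,y$ of $T$, $d_T(x,y)$ is the total weight of the unique $x$–$y$ path, and $L(T)$ is the set of leaves of $T$ (the vertex of a one-vertex tree counts as a leaf). A three-dimensional grid graph is a graph $P_{n_1}\square P_{n_2}\square P_{n_3}$ with $n_1,n_2,n_3$ positive integers: its vertex set is $\{(x_1,x_2,x_3)\in\mathbb{Z}^3: 0\le x_i\le n_i-1 \text{ for } i=1,2,3\}$, and two vertices are adjacent if and only if they differ by $1$ in exactly one coordinate and agree in every other coordinate. $k$-interval-PCG ($k\ge 1$): a graph $G=(V,E)$ is a $k$-interval-PCG if there exist a weighted tree $T$, a bijection $\zeta:V\to L(T)$, and pairwise disjoint closed intervals $I_1,\ldots,I_k$ such that for every pair of distinct vertices $u,v\in V$, $uv\in E$ if and only if $d_T(\zeta(u),\zeta(v))\in\bigcup_{j=1}^k I_j$. *)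

theory Defs
  imports "Graph_Theory.Graph_Theory"
begin

text \<open>
  Finite simple undirected graphs are the \<^locale>\<open>pair_graph\<close>s: each undirected edge is
  represented by its two arcs \<open>(u, v)\<close> and \<open>(v, u)\<close>.
\<close>

definition simple_graph :: "'a pair_pre_digraph \<Rightarrow> bool" where
  "simple_graph G \<longleftrightarrow> pair_graph G \<and> pverts G \<noteq> {}"

text \<open>
  The library's \<^const>\<open>tree\<close> is not usable here: it forbids every directed cycle, hence also
  the closed walk \<open>u, v, u\<close> along a single undirected edge. A cycle of an undirected simple
  graph is a \<^const>\<open>pre_digraph.cycle\<close> of length at least 3.
\<close>

definition undirected_tree :: "'v pair_pre_digraph \<Rightarrow> bool" where
  "undirected_tree T \<longleftrightarrow> simple_graph T \<and> Digraph_Component.connected (with_proj T) \<and>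
     (\<nexists>p. pre_digraph.cycle (with_proj T) p \<and> 3 \<le> length p)"

definition weighted_tree :: "'v pair_pre_digraph \<Rightarrow> ('v \<times> 'v) weight_fun \<Rightarrow> bool" where
  "weighted_tree T w \<longleftrightarrow> undirected_tree T \<and>
     (\<forall>u v. (u, v) \<in> parcs T \<longrightarrow> 0 < w (u, v) \<and> w (u, v) = w (v, u))"

text \<open>In a tree there is exactly one path between any two vertices, so the description is proper.\<close>

definition tree_path :: "'v pair_pre_digraph \<Rightarrow> 'v \<Rightarrow> 'v \<Rightarrow> ('v \<times> 'v) awalk" where
  "tree_path T x y = (THE p. pre_digraph.apath (with_proj T) x p y)"

definition tree_dist :: "'v pair_pre_digraph \<Rightarrow> ('v \<times> 'v) weight_fun \<Rightarrow> 'v \<Rightarrow> 'v \<Rightarrow> real" where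
  "tree_dist T w x y = sum_list (map w (tree_path T x y))"

text \<open>
  The out-degree of a vertex is its undirected degree, as each incident edge contributes
  exactly one outgoing arc.
\<close>

definition leaves :: "'v pair_pre_digraph \<Rightarrow> 'v set" where
  "leaves T = {v \<in> pverts T. out_degree (with_proj T) v = 1 \<or> pverts T = {v}}"

text \<open>
  The vertices of \<open>T\<close> are taken to be natural numbers; this is no restriction, as every finite
  tree is isomorphic to one of this kind. Intervals are bounded and nonempty, and may consist
  of a single point.
\<close>

definition interval_PCG :: "nat \<Rightarrow> 'a pair_pre_digraph \<Rightarrow> bool" where
  "interval_PCG k G \<longleftrightarrow> simple_graph G \<and>
     (\<exists>(T :: nat pair_pre_digraph) w \<zeta> (a :: nat \<Rightarrow> real) b.
        weighted_tree T w \<and>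
        bij_betw \<zeta> (pverts G) (leaves T) \<and>
        (\<forall>j<k. a j \<le> b j) \<and>
        disjoint_family_on (\<lambda>j. {a j..b j}) {..<k} \<and>
        (\<forall>u \<in> pverts G. \<forall>v \<in> pverts G. u \<noteq> v \<longrightarrow>
           ((u, v) \<in> parcs G \<longleftrightarrow> tree_dist T w (\<zeta> u) (\<zeta> v) \<in> (\<Union>j<k. {a j..b j}))))"

definition grid3_verts :: "nat \<Rightarrow> nat \<Rightarrow> nat \<Rightarrow> (int \<times> int \<times> int) set" where
  "grid3_verts n1 n2 n3 = {0..int n1 - 1} \<times> {0..int n2 - 1} \<times> {0..int n3 - 1}"

fun grid3_adj :: "int \<times> int \<times> int \<Rightarrow> int \<times> int \<times> int \<Rightarrow> bool" where
  "grid3_adj (x1, x2, x3) (y1, y2, y3) \<longleftrightarrow>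
     (\<bar>x1 - y1\<bar> = 1 \<and> x2 = y2 \<and> x3 = y3) \<or>
     (x1 = y1 \<and> \<bar>x2 - y2\<bar> = 1 \<and> x3 = y3) \<or>
     (x1 = y1 \<and> x2 = y2 \<and> \<bar>x3 - y3\<bar> = 1)"

definition grid3 :: "nat \<Rightarrow> nat \<Rightarrow> nat \<Rightarrow> (int \<times> int \<times> int) pair_pre_digraph" where
  "grid3 n1 n2 n3 = \<lparr>
     pverts = grid3_verts n1 n2 n3,
     parcs = {(x, y). x \<in> grid3_verts n1 n2 n3 \<and> y \<in> grid3_verts n1 n2 n3 \<and> grid3_adj x y}\<rparr>"

definition all_grid3_interval_PCG :: "nat \<Rightarrow> bool" where
  "all_grid3_interval_PCG k \<longleftrightarrow>
     (\<forall>n1 n2 n3. 1 \<le> n1 \<and> 1 \<le> n2 \<and> 1 \<le> n3 \<longrightarrow> interval_PCG k (grid3 n1 n2 n3))"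

end

theory Submission
  imports Defs "HOL-Library.Sublist"
begin

text \<open>
  Upper bound: place the vertex \<open>(x, y, z)\<close> at position \<open>n x + 2 n\<^sup>2 y + (2 n\<^sup>2 + 1) z\<close> of a long path
  and hang a leaf there. If \<open>n\<close> is large compared with the grid, two vertices are adjacent iff their
  positions differ by \<open>n\<close>, \<open>2 n\<^sup>2\<close> or \<open>2 n\<^sup>2 + 1\<close>, and the last two values share an interval that
  contains no other integer.

  Lower bound: the 3 by 3 by 3 grid is not a 1-interval-PCG. The four-point condition of tree metrics
  implies that in every 3 by 3 matrix of distances \<open>d(u\<^sub>i, v\<^sub>j)\<close> the largest of the six permutation sums
  occurs at least twice. Every nonadjacent pair has distance below or above the interval. If these
  alternatives are treated as propositional variables, each 3 by 3 matrix excludes all assignments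
  for which one permutation sum is certain to exceed the other five, and the resulting
  propositional problem is unsatisfiable.
\<close>

section \<open>Tree metrics\<close>

text \<open>The grid is bipartite, and the refutation uses only distances between a point of odd and
  a point of even coordinate sum. In the cube these form a 14 by 13 matrix: 54 entries belong to
  adjacent pairs, the other 128 are the propositional variables. A single four-point condition
  always involves distances within a colour class or at most a 2 by 2 block; the condition on 3 by 3
  minors is a consequence of several of them from which all distances within the classes have been
  eliminated. A representing tree need not share the symmetries of the cube, so none can be assumed
  of the distances. Symmetry acts on clauses instead, each of which is proved for every possible
  distance function. In the upper bound three directions have to share two intervals. Distances
  between comb leaves are integers, so two consecutive step lengths fit into one interval with
  nothing between them. The price is that a \<open>y\<close> step and an opposite \<open>z\<close>
  step nearly cancel, leaving a difference of 1, which is harmless because \<open>n\<close> is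
  larger than 1.\<close>

lemma undirected_tree_pair_graph: "undirected_tree T \<Longrightarrow> pair_graph T"
  by (simp add: undirected_tree_def simple_graph_def)

lemma (in pre_digraph) cas_imp_end_in_awalk_verts: "cas u p v \<Longrightarrow> v \<in> set (awalk_verts u p)"
  by (induction p arbitrary: u) auto

text \<open>Where two paths part, following one until it meets the other again and returning along
  the other closes a cycle of at least three arcs. The induction strips common first arcs.\<close>

lemma tree_apath_unique:
  assumes T: "undirected_tree T"
    and "pre_digraph.apath (with_proj T) x p y" "pre_digraph.apath (with_proj T) x q y"
  shows "p = q"
proof -
  interpret pair_graph T using T by (rule undirected_tree_pair_graph)
  show ?thesis using assms(2,3)
  proof (induction p arbitrary: x q)
    case Nil
    then show ?case by (metis apath_Nil_iff apath_ends)
  next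
    case (Cons e p')
    obtain a where e: "e = (x, a)" using Cons.prems(1) by (cases e) (auto simp: apath_Cons_iff)
    have ap: "apath a p' y" "x \<notin> set (awalk_verts a p')" and ea: "(x,a) \<in> parcs T"
      using Cons.prems(1) e by (auto simp: apath_Cons_iff)
    have "q \<noteq> []" using Cons.prems by (metis apath_ends apath_Nil_iff list.distinct(1))
    then obtain b q' where q: "q = (x, b) # q'" using Cons.prems(2)
      by (cases q) (auto simp: apath_Cons_iff)
    have bq: "apath b q' y" "x \<notin> set (awalk_verts b q')" and eb: "(x,b) \<in> parcs T"
      using Cons.prems(2) q by (auto simp: apath_Cons_iff)
    show ?case
    proof (cases "a = b")
      case True
      then show ?thesis using Cons.IH[OF ap(1)] bq e q by auto
    next
      case False
      have wa: "awalk a p' y" and wb: "awalk b q' y" using ap bq by (auto simp: apath_def)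
      have "y \<in> set (awalk_verts a p')" "y \<in> set (awalk_verts b q')"
        using wa wb by (simp_all only: awalk_def cas_imp_end_in_awalk_verts)
      \<comment> \<open>Choosing the first vertex of \<open>p'\<close> that lies on
        \<open>q'\<close> keeps the two halves of the cycle disjoint apart from their ends.\<close>
      then obtain xs z ys where sp: "awalk_verts a p' = xs @ z # ys" "z \<in> set (awalk_verts b q')"
          "\<forall>v\<in>set xs. v \<notin> set (awalk_verts b q')"
        using split_list_first_prop[of "awalk_verts a p'" "\<lambda>v. v \<in> set (awalk_verts b q')"] by blast
      obtain us vs where sq: "awalk_verts b q' = us @ z # vs" using sp(2) by (meson split_list)
      have ca: "cas a p' y" and cb: "cas b q' y" using wa wb by (simp_all add: awalk_def)
      obtain p1 p2 where p1: "cas a p1 z" "cas z p2 y" "p' = p1 @ p2"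
          "awalk_verts a p1 = xs @ [z]" "awalk_verts z p2 = z # ys"
        by (rule awalk_decomp_verts[OF ca sp(1)])
      obtain q1 q2 where q1: "cas b q1 z" "cas z q2 y" "q' = q1 @ q2"
          "awalk_verts b q1 = us @ [z]" "awalk_verts z q2 = z # vs"
        by (rule awalk_decomp_verts[OF cb sq])
      have w1: "awalk x ((x,a) # p1) z" using p1 wa ea in_arcsD1[OF ea]
        by (auto simp: awalk_Cons_iff awalk_def)
      have w2: "awalk x ((x,b) # q1) z" using q1 wb eb in_arcsD1[OF eb]
        by (auto simp: awalk_Cons_iff awalk_def)
      have w2': "awalk z (rev_path ((x,b) # q1)) x" using w2 by (simp only: awalk_rev_path)
      let ?c = "((x,a) # p1) @ rev_path ((x,b) # q1)"
      have wc: "awalk x ?c x" using w1 w2' by (rule awalk_appendI)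
      have last: "awlast x ((x,a) # p1) = z" using w1 by auto
      have "awalk_verts x ?c = (x # xs @ [z]) @ tl (rev (x # us @ [z]))"
        using awalk_verts_append[OF wc] p1(4) q1(4) last awalk_verts_rev_path[OF w2] by simp
      then have "tl (awalk_verts x ?c) = xs @ [z] @ rev us @ [x]" by simp
      moreover have "distinct (xs @ [z])" "distinct (us @ [z])"
        using ap(1) bq(1) sp(1) sq by (simp_all add: apath_def)
      moreover have "set xs \<inter> set us = {}" "x \<notin> set xs" "x \<noteq> z" "x \<notin> set us"
        using sp sq ap(2) bq(2) by auto
      ultimately have d: "distinct (tl (awalk_verts x ?c))" by auto
      \<comment> \<open>If both halves were single arcs, they would both end in \<open>z\<close>,
        against \<open>a \<noteq> b\<close>. This rules out the closed walk \<open>x, z, x\<close>,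
        which also satisfies \<open>cycle\<close>.\<close>
      have "p1 \<noteq> [] \<or> q1 \<noteq> []" using p1(1) q1(1) False by auto
      then have "3 \<le> length ?c" by (cases p1; cases q1) auto
      moreover have "cycle ?c" unfolding cycle_def using wc d by blast
      ultimately show ?thesis using T unfolding undirected_tree_def by blast
    qed
  qed
qed

lemma tree_path_eqI:
  assumes "undirected_tree T" "pre_digraph.apath (with_proj T) x p y"
  shows "tree_path T x y = p"
  unfolding tree_path_def using assms(2) by (rule the_equality) (rule tree_apath_unique[OF assms(1) _ assms(2)])

lemma tree_apath_tree_path:
  assumes "undirected_tree T" "x \<in> pverts T" "y \<in> pverts T"
  shows "pre_digraph.apath (with_proj T) x (tree_path T x y) y"
proof -
  interpret pair_graph T using assms(1) by (rule undirected_tree_pair_graph)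
  have "strongly_connected (with_proj T)"
    using assms(1) symmetric_connected_imp_strongly_connected sym_arcs
    unfolding undirected_tree_def by blast
  then have "x \<rightarrow>\<^sup>*\<^bsub>with_proj T\<^esub> y" using assms by (auto simp: strongly_connected_def)
  then obtain p where "apath x p y" by (auto simp: reachable_apath)
  then show ?thesis using tree_path_eqI[OF assms(1)] by metis
qed

lemma sum_list_rev_path:
  assumes "weighted_tree T w" "set p \<subseteq> parcs T"
  shows "sum_list (map w (rev_path p)) = sum_list (map w p)"
  using assms(2)
proof (induction p)
  case (Cons e p)
  obtain a b where e: "e = (a, b)" by (cases e)
  then have "w (a, b) = w (b, a)" using Cons.prems assms(1) unfolding weighted_tree_def by auto
  then show ?case using Cons e by simp
qed simp

lemma sum_list_prefix_le:
  assumes "weighted_tree T w" "set q \<subseteq> parcs T" "prefix p q"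
  shows "sum_list (map w p) \<le> sum_list (map w q)"
proof -
  obtain r where r: "q = p @ r" using assms(3) by (auto simp: prefix_def)
  have "0 \<le> sum_list (map w r)"
    using assms(1,2) r by (intro sum_list_nonneg) (force simp: weighted_tree_def)
  then show ?thesis using r by simp
qed

section \<open>Gromov products and the four-point condition\<close>

text \<open>Twice the Gromov product of \<open>x\<close> and \<open>y\<close> with respect to the root \<open>r\<close>.\<close>

definition shared_weight :: "'v pair_pre_digraph \<Rightarrow> ('v \<times> 'v) weight_fun \<Rightarrow> 'v \<Rightarrow> 'v \<Rightarrow> 'v \<Rightarrow> real" where
  "shared_weight T w r x y =
     2 * sum_list (map w (longest_common_prefix (tree_path T r x) (tree_path T r y)))"

lemma longest_common_prefix_commute: "longest_common_prefix xs ys = longest_common_prefix ys xs"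
  by (induction xs ys rule: longest_common_prefix.induct) auto

lemma longest_common_prefix_hd_neq:
  assumes "longest_common_prefix xs ys = c"
  obtains a b where "xs = c @ a" "ys = c @ b" "a = [] \<or> b = [] \<or> hd a \<noteq> hd b"
proof -
  obtain a b where ab: "xs = c @ a" "ys = c @ b"
    using assms longest_common_prefix_prefix1 longest_common_prefix_prefix2 by (metis prefix_def)
  have "a = [] \<or> b = [] \<or> hd a \<noteq> hd b"
  proof (rule ccontr)
    assume "\<not> ?thesis"
    then have "prefix (c @ [hd a]) xs" "prefix (c @ [hd a]) ys"
      using ab by (cases a; cases b; auto)+
    then have "prefix (c @ [hd a]) c" using longest_common_prefix_max_prefix assms by metis
    then show False by (auto simp: prefix_def)
  qed
  with ab show ?thesis by (rule that)
qed

lemma shared_weight_commute: "shared_weight T w r x y = shared_weight T w r y x"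
  unfolding shared_weight_def by (subst longest_common_prefix_commute) (rule refl)

text \<open>Both common prefixes are initial segments of the path to \<open>y\<close>, so one
  extends the other. The shorter one is then common to the paths to \<open>x\<close> and
  \<open>z\<close>, and positive weights turn the prefix order into an order of weights.\<close>

lemma shared_weight_ultrametric:
  assumes W: "weighted_tree T w" and V: "r \<in> pverts T" "x \<in> pverts T" "y \<in> pverts T" "z \<in> pverts T"
  shows "min (shared_weight T w r x y) (shared_weight T w r y z) \<le> shared_weight T w r x z"
proof -
  have T: "undirected_tree T" using W by (simp add: weighted_tree_def)
  interpret pair_graph T using T by (rule undirected_tree_pair_graph)
  let ?P = "tree_path T r" and ?l = longest_common_prefix
  have arcs: "set (?P v) \<subseteq> parcs T" if "v \<in> pverts T" for v
    using tree_apath_tree_path[OF T V(1) that] by (auto simp: apath_def awalk_def)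
  have pre: "prefix (?l (?P x) (?P y)) (?l (?P x) (?P z)) \<or> prefix (?l (?P y) (?P z)) (?l (?P x) (?P z))"
    by (meson longest_common_prefix_max_prefix longest_common_prefix_prefix1
        longest_common_prefix_prefix2 prefix_order.trans prefix_same_cases)
  have "set (?l (?P x) (?P z)) \<subseteq> parcs T"
    using arcs[OF V(2)] longest_common_prefix_prefix1[of "?P x" "?P z"]
    by (meson order_trans set_mono_prefix)
  from sum_list_prefix_le[OF W this] pre show ?thesis
    unfolding shared_weight_def by (auto simp: min_le_iff_disj)
qed

text \<open>The root paths to \<open>x\<close> and \<open>y\<close> separate at a vertex
  \<open>m\<close> and never meet again, so the path from \<open>x\<close> to \<open>y\<close> runs
  back to \<open>m\<close> and then on to \<open>y\<close>.\<close>

lemma tree_dist_rooted: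
  assumes W: "weighted_tree T w" and V: "r \<in> pverts T" "x \<in> pverts T" "y \<in> pverts T"
  shows "tree_dist T w x y = tree_dist T w r x + tree_dist T w r y - shared_weight T w r x y"
proof -
  have T: "undirected_tree T" using W by (simp add: weighted_tree_def)
  interpret pair_graph T using T by (rule undirected_tree_pair_graph)
  let ?P = "tree_path T r"
  have Px: "apath r (?P x) x" and Py: "apath r (?P y) y" by (simp_all add: tree_apath_tree_path T V)
  obtain a b where ab: "?P x = longest_common_prefix (?P x) (?P y) @ a"
      "?P y = longest_common_prefix (?P x) (?P y) @ b" "a = [] \<or> b = [] \<or> hd a \<noteq> hd b"
    by (rule longest_common_prefix_hd_neq[OF refl])
  define c where "c = longest_common_prefix (?P x) (?P y)"
  note ab = ab[folded c_def]
  define m where "m = awlast r c"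
  have c: "apath r c m" and a: "apath m a x" and b: "apath m b y"
    using Px Py ab unfolding m_def by (auto simp: apath_append_iff)
  have wa: "awalk m a x" and wb: "awalk m b y" using a b by (simp_all add: apath_def)
  \<comment> \<open>A second meeting point would give two paths from \<open>m\<close> to it; these
    are equal by uniqueness, yet they start with different arcs.\<close>
  have meet: "z = m" if z: "z \<in> set (awalk_verts m a)" "z \<in> set (awalk_verts m b)" for z
  proof (rule ccontr)
    assume zm: "z \<noteq> m"
    obtain a1 a2 where a1: "a = a1 @ a2" "awalk m a1 z"
      using awalk_decomp[OF wa z(1)] by blast
    obtain b1 b2 where b1: "b = b1 @ b2" "awalk m b1 z"
      using awalk_decomp[OF wb z(2)] by blast
    have ne: "a1 \<noteq> []" "b1 \<noteq> []" using a1 b1 zm by (auto simp: awalk_Nil_iff)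
    have "apath m a1 z" "apath m b1 z"
      using a b a1 b1 by (auto simp: apath_append_iff dest: awlast_of_awalk)
    then have "a1 = b1" using tree_apath_unique[OF T] by blast
    then show False using ab(3) a1 b1 ne by auto
  qed
  have ra: "apath x (rev_path a) m" using a by simp
  have "apath x (rev_path a @ b) y"
  proof -
    have l: "awlast x (rev_path a) = m" using ra by (auto simp: apath_def)
    have "set (awalk_verts x (rev_path a)) = set (awalk_verts m a)"
      using awalk_verts_rev_path[of m a x] a by (simp add: apath_def)
    moreover have "m \<notin> set (tl (awalk_verts m b))"
      using b by (cases b) (auto simp: apath_def)
    moreover have "set (tl (awalk_verts m b)) \<subseteq> set (awalk_verts m b)"
      by (cases b) auto
    ultimately have "set (awalk_verts x (rev_path a)) \<inter> set (tl (awalk_verts m b)) = {}"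
      using meet by blast
    then show ?thesis using ra b l by (simp add: apath_append_iff)
  qed
  then have "tree_path T x y = rev_path a @ b" by (rule tree_path_eqI[OF T])
  moreover have "set a \<subseteq> parcs T" using a by (auto simp: apath_def awalk_def)
  ultimately have "tree_dist T w x y = sum_list (map w a) + sum_list (map w b)"
    unfolding tree_dist_def using sum_list_rev_path[OF W] by simp
  moreover have "tree_dist T w r x = sum_list (map w c) + sum_list (map w a)"
    "tree_dist T w r y = sum_list (map w c) + sum_list (map w b)"
    unfolding tree_dist_def using ab(1,2) by (metis map_append sum_list_append)+
  moreover have "shared_weight T w r x y = 2 * sum_list (map w c)"
    unfolding shared_weight_def c_def by simp
  ultimately show ?thesis by simp
qed

lemma tree_dist_commute:
  assumes "weighted_tree T w" "x \<in> pverts T" "y \<in> pverts T"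
  shows "tree_dist T w x y = tree_dist T w y x"
  using tree_dist_rooted[OF assms(1,2,2,3)] tree_dist_rooted[OF assms(1,2,3,2)]
  by (metis shared_weight_commute add.commute)

text \<open>With \<open>t\<close> as the root, the distances to \<open>t\<close> contribute the same
  amount to all three sums, and what is left is the ultrametric inequality for
  \<open>shared_weight\<close>.\<close>

lemma tree_dist_four_point:
  assumes W: "weighted_tree T w"
    and V: "x \<in> pverts T" "y \<in> pverts T" "z \<in> pverts T" "t \<in> pverts T"
  shows "tree_dist T w x y + tree_dist T w z t \<le> tree_dist T w x z + tree_dist T w y t \<or>
    tree_dist T w x y + tree_dist T w z t \<le> tree_dist T w x t + tree_dist T w y z"
proof -
  let ?g = "shared_weight T w t"
  have d: "tree_dist T w u v = tree_dist T w t u + tree_dist T w t v - ?g u v"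
    if "u \<in> pverts T" "v \<in> pverts T" for u v
    using tree_dist_rooted[OF W V(4) that] .
  have "min (?g x z) (?g z y) \<le> ?g x y" by (rule shared_weight_ultrametric[OF W V(4,1,3,2)])
  then have "?g x z \<le> ?g x y \<or> ?g y z \<le> ?g x y" 
    unfolding shared_weight_commute[of T w t z y] by (simp only: min_le_iff_disj)
  then show ?thesis
    using d[OF V(1,2)] d[OF V(1,3)] d[OF V(2,3)] tree_dist_commute[OF W V(4,3)]
      tree_dist_commute[OF W V(4,1)] tree_dist_commute[OF W V(4,2)] by linarith
qed

section \<open>Singularity of 3 by 3 minors\<close>

text \<open>Tropical (max-plus) singularity of every 3 by 3 minor. Testing the main diagonal
  suffices, since the columns may be listed in any order.\<close>

definition minors_singular :: "'v set \<Rightarrow> ('v \<Rightarrow> 'v \<Rightarrow> real) \<Rightarrow> bool" where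
  "minors_singular S D \<longleftrightarrow> (\<forall>u1\<in>S. \<forall>u2\<in>S. \<forall>u3\<in>S. \<forall>v1\<in>S. \<forall>v2\<in>S. \<forall>v3\<in>S.
     D u1 v1 + D u2 v2 + D u3 v3 \<le> D u1 v2 + D u2 v1 + D u3 v3 \<or>
     D u1 v1 + D u2 v2 + D u3 v3 \<le> D u1 v3 + D u2 v2 + D u3 v1 \<or>
     D u1 v1 + D u2 v2 + D u3 v3 \<le> D u1 v1 + D u2 v3 + D u3 v2 \<or>
     D u1 v1 + D u2 v2 + D u3 v3 \<le> D u1 v2 + D u2 v3 + D u3 v1 \<or>
     D u1 v1 + D u2 v2 + D u3 v3 \<le> D u1 v3 + D u2 v1 + D u3 v2)"

definition max_twice :: "real \<Rightarrow> real \<Rightarrow> real \<Rightarrow> bool" where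
  "max_twice r s t \<longleftrightarrow> (r \<le> s \<or> r \<le> t) \<and> (s \<le> r \<or> s \<le> t) \<and> (t \<le> r \<or> t \<le> s)"

text \<open>There is one hypothesis for each four-element subset of the six points. In a tree, if
  the diagonal strictly beats all three transpositions, then the paths from \<open>u_i\<close> to
  \<open>v_i\<close> pairwise share an edge that they traverse in opposite directions. Three such
  paths form a tripod, and there a cyclic permutation attains the same sum. Plain variables in place
  of distances make this a problem of linear arithmetic.\<close>

lemma max_twice_imp_minor_singular:
  assumes
    "max_twice (u1_u2 + u3_v1) (u1_u3 + u2_v1) (u1_v1 + u2_u3)"
    and "max_twice (u1_u2 + u3_v2) (u1_u3 + u2_v2) (u1_v2 + u2_u3)"
    and "max_twice (u1_u2 + u3_v3) (u1_u3 + u2_v3) (u1_v3 + u2_u3)"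
    and "max_twice (u1_u2 + v1_v2) (u1_v1 + u2_v2) (u1_v2 + u2_v1)"
    and "max_twice (u1_u2 + v1_v3) (u1_v1 + u2_v3) (u1_v3 + u2_v1)"
    and "max_twice (u1_u2 + v2_v3) (u1_v2 + u2_v3) (u1_v3 + u2_v2)"
    and "max_twice (u1_u3 + v1_v2) (u1_v1 + u3_v2) (u1_v2 + u3_v1)"
    and "max_twice (u1_u3 + v1_v3) (u1_v1 + u3_v3) (u1_v3 + u3_v1)"
    and "max_twice (u1_u3 + v2_v3) (u1_v2 + u3_v3) (u1_v3 + u3_v2)"
    and "max_twice (u1_v1 + v2_v3) (u1_v2 + v1_v3) (u1_v3 + v1_v2)"
    and "max_twice (u2_u3 + v1_v2) (u2_v1 + u3_v2) (u2_v2 + u3_v1)"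
    and "max_twice (u2_u3 + v1_v3) (u2_v1 + u3_v3) (u2_v3 + u3_v1)"
    and "max_twice (u2_u3 + v2_v3) (u2_v2 + u3_v3) (u2_v3 + u3_v2)"
    and "max_twice (u2_v1 + v2_v3) (u2_v2 + v1_v3) (u2_v3 + v1_v2)"
    and "max_twice (u3_v1 + v2_v3) (u3_v2 + v1_v3) (u3_v3 + v1_v2)"
  shows "u1_v1 + u2_v2 + u3_v3 \<le> u1_v2 + u2_v1 + u3_v3 \<or>
    u1_v1 + u2_v2 + u3_v3 \<le> u1_v3 + u2_v2 + u3_v1 \<or>
    u1_v1 + u2_v2 + u3_v3 \<le> u1_v1 + u2_v3 + u3_v2 \<or>
    u1_v1 + u2_v2 + u3_v3 \<le> u1_v2 + u2_v3 + u3_v1 \<or>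
    u1_v1 + u2_v2 + u3_v3 \<le> u1_v3 + u2_v1 + u3_v2"
  using assms unfolding max_twice_def by (smt (verit))

lemma four_point_imp_minors_singular:
  fixes D :: "'v \<Rightarrow> 'v \<Rightarrow> real"
  assumes commute: "\<And>x y. x \<in> S \<Longrightarrow> y \<in> S \<Longrightarrow> D x y = D y x"
    and four_point: "\<And>x y z t. x \<in> S \<Longrightarrow> y \<in> S \<Longrightarrow> z \<in> S \<Longrightarrow> t \<in> S \<Longrightarrow>
      D x y + D z t \<le> D x z + D y t \<or> D x y + D z t \<le> D x t + D y z"
  shows "minors_singular S D"
  unfolding minors_singular_def
proof (intro ballI)
  fix u1 u2 u3 v1 v2 v3
  assume m: "u1 \<in> S" "u2 \<in> S" "u3 \<in> S" "v1 \<in> S" "v2 \<in> S" "v3 \<in> S"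
  have fp: "max_twice (D x y + D z t) (D x z + D y t) (D x t + D y z)"
    if "x \<in> S" "y \<in> S" "z \<in> S" "t \<in> S" for x y z t
    using four_point[OF that] four_point[OF that(1,3,2,4)] four_point[OF that(1,4,2,3)]
    unfolding max_twice_def commute[OF that(3,2)] commute[OF that(4,3)] commute[OF that(4,2)] by blast
  show "D u1 v1 + D u2 v2 + D u3 v3 \<le> D u1 v2 + D u2 v1 + D u3 v3 \<or>
     D u1 v1 + D u2 v2 + D u3 v3 \<le> D u1 v3 + D u2 v2 + D u3 v1 \<or>
     D u1 v1 + D u2 v2 + D u3 v3 \<le> D u1 v1 + D u2 v3 + D u3 v2 \<or>
     D u1 v1 + D u2 v2 + D u3 v3 \<le> D u1 v2 + D u2 v3 + D u3 v1 \<or>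
     D u1 v1 + D u2 v2 + D u3 v3 \<le> D u1 v3 + D u2 v1 + D u3 v2"
    by (rule max_twice_imp_minor_singular) (rule fp m)+
qed

section \<open>The 3 by 3 by 3 grid\<close>

type_synonym point = "int \<times> int \<times> int"

text \<open>Centred at the origin, so that the symmetries are the signed permutations of the
  coordinates.\<close>

definition cube :: "point set" where
  "cube = {-1..1} \<times> {-1..1} \<times> {-1..1}"

definition cube_model :: "real \<Rightarrow> real \<Rightarrow> (point \<Rightarrow> point \<Rightarrow> real) \<Rightarrow> bool" where
  "cube_model a b D \<longleftrightarrow> a \<le> b \<and> minors_singular cube D \<and>
     (\<forall>u\<in>cube. \<forall>v\<in>cube. u \<noteq> v \<longrightarrow>
        (if grid3_adj u v then a \<le> D u v \<and> D u v \<le> b else D u v < a \<or> b < D u v))"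

text \<open>The literal \<open>(u, v, True)\<close> says that \<open>u\<close> and \<open>v\<close> are too far apart to be adjacent,
  \<open>(u, v, False)\<close> that they are too near.\<close>

type_synonym literal = "point \<times> point \<times> bool"

fun holds :: "real \<Rightarrow> real \<Rightarrow> (point \<Rightarrow> point \<Rightarrow> real) \<Rightarrow> literal \<Rightarrow> bool" where
  "holds a b D (u, v, f) \<longleftrightarrow> (if f then b < D u v else D u v < a)"

fun negate :: "literal \<Rightarrow> literal" where
  "negate (u, v, f) = (u, v, \<not> f)"

fun in_cube :: "point \<Rightarrow> bool" where
  "in_cube (x, y, z) \<longleftrightarrow> -1 \<le> x \<and> x \<le> 1 \<and> -1 \<le> y \<and> y \<le> 1 \<and> -1 \<le> z \<and> z \<le> 1"

fun nonadjacent :: "literal \<Rightarrow> bool" where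
  "nonadjacent (u, v, f) \<longleftrightarrow> in_cube u \<and> in_cube v \<and> u \<noteq> v \<and> \<not> grid3_adj u v"

lemma in_cube_iff: "in_cube u \<longleftrightarrow> u \<in> cube"
  by (cases u) (auto simp: cube_def)

lemma cube_modelD:
  assumes "cube_model a b D" "in_cube u" "in_cube v" "u \<noteq> v"
  shows "if grid3_adj u v then a \<le> D u v \<and> D u v \<le> b else D u v < a \<or> b < D u v"
  using assms unfolding cube_model_def in_cube_iff by blast

text \<open>"Not too far" amounts to "too near" only because the distance of a nonadjacent pair lies
  outside the interval. For this reason the checker tests every clause and every derived literal
  with \<open>nonadjacent\<close>.\<close>

lemma holds_negate:
  assumes "cube_model a b D" "nonadjacent l" "\<not> holds a b D l"
  shows "holds a b D (negate l)"
proof -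
  obtain u v f where l: "l = (u, v, f)" by (cases l)
  then show ?thesis using cube_modelD[OF assms(1), of u v] assms(2,3) by (cases f) simp_all
qed

section \<open>Symmetries of the cube\<close>

datatype axes = XYZ | XZY | YXZ | YZX | ZXY | ZYX

fun permute :: "axes \<Rightarrow> point \<Rightarrow> point" where
  "permute XYZ (x, y, z) = (x, y, z)"
| "permute XZY (x, y, z) = (x, z, y)"
| "permute YXZ (x, y, z) = (y, x, z)"
| "permute YZX (x, y, z) = (y, z, x)"
| "permute ZXY (x, y, z) = (z, x, y)"
| "permute ZYX (x, y, z) = (z, y, x)"

type_synonym cube_symmetry = "axes \<times> bool \<times> bool \<times> bool"

fun flip :: "bool \<times> bool \<times> bool \<Rightarrow> point \<Rightarrow> point" where
  "flip (r, s, t) (x, y, z) = (if r then - x else x, if s then - y else y, if t then - z else z)"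

definition act :: "cube_symmetry \<Rightarrow> point \<Rightarrow> point" where
  "act \<sigma> u = flip (snd \<sigma>) (permute (fst \<sigma>) u)"

fun act_literal :: "cube_symmetry \<Rightarrow> literal \<Rightarrow> literal" where
  "act_literal \<sigma> (u, v, f) = (act \<sigma> u, act \<sigma> v, f)"

lemma abs_diff_flip:
  fixes x y :: int
  shows "\<bar>(if r then - x else x) - (if r then - y else y)\<bar> = \<bar>x - y\<bar>"
  by (simp add: abs_minus_commute)

lemma flip_eq_iff:
  fixes x y :: int
  shows "(if r then - x else x) = (if r then - y else y) \<longleftrightarrow> x = y"
  by simp

lemma permute_in_cube: "u \<in> cube \<Longrightarrow> permute p u \<in> cube"
  by (cases u; cases p) (simp_all add: cube_def)

lemma permute_eq_iff: "permute p u = permute p v \<longleftrightarrow> u = v"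
  by (cases u; cases v; cases p) auto

lemma grid3_adj_permute: "grid3_adj (permute p u) (permute p v) \<longleftrightarrow> grid3_adj u v"
  by (cases u; cases v; cases p) auto

lemma act_in_cube:
  assumes "u \<in> cube"
  shows "act \<sigma> u \<in> cube"
proof -
  obtain x y z where "permute (fst \<sigma>) u = (x, y, z)" by (metis prod.exhaust)
  moreover obtain r s t where "snd \<sigma> = (r, s, t)" by (metis prod.exhaust)
  ultimately show ?thesis using permute_in_cube[OF assms, of "fst \<sigma>"]
    by (simp add: act_def cube_def)
qed

lemma act_eq_iff: "act \<sigma> u = act \<sigma> v \<longleftrightarrow> u = v"
proof -
  obtain r s t where "snd \<sigma> = (r, s, t)" by (metis prod.exhaust)
  then have "act \<sigma> u = act \<sigma> v \<longleftrightarrow> permute (fst \<sigma>) u = permute (fst \<sigma>) v"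
    by (cases "permute (fst \<sigma>) u"; cases "permute (fst \<sigma>) v") (simp only: act_def flip.simps prod.inject flip_eq_iff)
  then show ?thesis by (simp add: permute_eq_iff)
qed

lemma grid3_adj_act: "grid3_adj (act \<sigma> u) (act \<sigma> v) \<longleftrightarrow> grid3_adj u v"
proof -
  obtain r s t where "snd \<sigma> = (r, s, t)" by (metis prod.exhaust)
  then have "grid3_adj (act \<sigma> u) (act \<sigma> v) \<longleftrightarrow>
      grid3_adj (permute (fst \<sigma>) u) (permute (fst \<sigma>) v)"
    by (cases "permute (fst \<sigma>) u"; cases "permute (fst \<sigma>) v")
      (simp only: act_def flip.simps grid3_adj.simps flip_eq_iff abs_diff_flip)
  then show ?thesis by (simp add: grid3_adj_permute)
qed

text \<open>A symmetry need not preserve distances, but it carries minors to minors and adjacent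
  pairs to adjacent pairs. So the transformed distances obey the same constraints with the same
  interval.\<close>

lemma cube_model_act:
  assumes "cube_model a b D"
  shows "cube_model a b (\<lambda>u v. D (act \<sigma> u) (act \<sigma> v))"
proof -
  have sing: "minors_singular cube D" using assms by (simp add: cube_model_def)
  have "minors_singular cube (\<lambda>u v. D (act \<sigma> u) (act \<sigma> v))"
    unfolding minors_singular_def
    by (intro ballI) (rule sing[unfolded minors_singular_def, rule_format]; erule act_in_cube)
  then show ?thesis
    using assms unfolding cube_model_def by (simp add: act_in_cube act_eq_iff grid3_adj_act)
qed

lemma holds_act: "holds a b (\<lambda>u v. D (act \<sigma> u) (act \<sigma> v)) l \<longleftrightarrow> holds a b D (act_literal \<sigma> l)"
  by (cases l) auto

section \<open>Comparing sums of distances by status\<close>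

datatype status = Near | Adjacent | Far | Unknown

text \<open>Pairs are looked up in this orientation only: the certificate always puts the point of
  odd coordinate sum first, and the symmetries preserve this parity.\<close>

definition status :: "literal list \<Rightarrow> point \<Rightarrow> point \<Rightarrow> status" where
  "status A u v = (if grid3_adj u v then Adjacent
     else if List.member A (u, v, True) then Far
     else if List.member A (u, v, False) then Near else Unknown)"

fun at_least_adjacent :: "status \<Rightarrow> bool" where
  "at_least_adjacent s \<longleftrightarrow> s = Adjacent \<or> s = Far"

fun at_most_adjacent :: "status \<Rightarrow> bool" where
  "at_most_adjacent s \<longleftrightarrow> s = Near \<or> s = Adjacent"

text \<open>A far pair has distance above \<open>b\<close>, an adjacent one between \<open>a\<close> and \<open>b\<close>, a near one below
  \<open>a\<close>; so each far pair on the left makes up for one adjacent pair on the right.\<close>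

definition surely_greater :: "status list \<Rightarrow> status list \<Rightarrow> bool" where
  "surely_greater ss ts \<longleftrightarrow> list_all at_least_adjacent ss \<and> list_all at_most_adjacent ts \<and>
     length (filter (\<lambda>t. t = Adjacent) ts) \<le> length (filter (\<lambda>s. s = Far) ss)"

fun compatible :: "real \<Rightarrow> real \<Rightarrow> status \<Rightarrow> real \<Rightarrow> bool" where
  "compatible a b Near x \<longleftrightarrow> x < a"
| "compatible a b Adjacent x \<longleftrightarrow> a \<le> x \<and> x \<le> b"
| "compatible a b Far x \<longleftrightarrow> b < x"
| "compatible a b Unknown x \<longleftrightarrow> True"

text \<open>Measured from \<open>a\<close> per term, an adjacent pair contributes at least 0 and a
  far pair more than \<open>b - a\<close>; hence the bound is strict once a far pair occurs.\<close>

lemma sum_list_lower: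
  assumes "list_all2 (compatible a b) ss xs" "list_all at_least_adjacent ss" "a \<le> b"
  shows "real (length ss) * a + real (length (filter (\<lambda>s. s = Far) ss)) * (b - a) \<le> sum_list xs \<and>
    (filter (\<lambda>s. s = Far) ss \<noteq> [] \<longrightarrow>
      real (length ss) * a + real (length (filter (\<lambda>s. s = Far) ss)) * (b - a) < sum_list xs)"
  using assms
proof (induction ss xs rule: list_all2_induct)
  case (Cons s ss x xs)
  then show ?case by (cases s) (auto simp: algebra_simps)
qed simp

text \<open>Dually, an adjacent pair contributes at most \<open>b - a\<close> and a near pair less
  than 0; hence the bound is strict once a near pair occurs.\<close>

lemma sum_list_upper:
  assumes "list_all2 (compatible a b) ts ys" "list_all at_most_adjacent ts" "a \<le> b"
  shows "sum_list ys \<le> real (length ts) * a + real (length (filter (\<lambda>t. t = Adjacent) ts)) * (b - a) \<and>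
    (length (filter (\<lambda>t. t = Adjacent) ts) < length ts \<longrightarrow>
      sum_list ys < real (length ts) * a + real (length (filter (\<lambda>t. t = Adjacent) ts)) * (b - a))"
  using assms
proof (induction ts ys rule: list_all2_induct)
  case (Cons t ts y ys)
  then show ?case by (cases t) (auto simp: algebra_simps)
qed simp

lemma surely_greater_sum_list:
  assumes "surely_greater ss ts" "a \<le> b" "length ss = length ts" "ts \<noteq> []"
    and "list_all2 (compatible a b) ss xs" "list_all2 (compatible a b) ts ys"
  shows "sum_list ys < sum_list xs"
proof -
  let ?f = "length (filter (\<lambda>s. s = Far) ss)" and ?g = "length (filter (\<lambda>t. t = Adjacent) ts)"
  have le: "?g \<le> ?f" using assms(1) by (simp add: surely_greater_def)
  have xs: "real (length ss) * a + real ?f * (b - a) \<le> sum_list xs \<and>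
    (filter (\<lambda>s. s = Far) ss \<noteq> [] \<longrightarrow> real (length ss) * a + real ?f * (b - a) < sum_list xs)"
    using sum_list_lower[OF assms(5)] assms by (simp add: surely_greater_def)
  have ys: "sum_list ys \<le> real (length ts) * a + real ?g * (b - a) \<and>
    (?g < length ts \<longrightarrow> sum_list ys < real (length ts) * a + real ?g * (b - a))"
    using sum_list_upper[OF assms(6)] assms by (simp add: surely_greater_def)
  have "real ?g * (b - a) \<le> real ?f * (b - a)" using le assms(2) by (intro mult_right_mono) auto
  \<comment> \<open>Source of the strictness: without a far pair on the left there is no adjacent
    pair on the right, so the nonempty right side consists of near pairs.\<close>
  moreover have "filter (\<lambda>s. s = Far) ss \<noteq> [] \<or> ?g < length ts"
    using le assms(3,4) by (cases "?f = 0") auto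
  ultimately show ?thesis using xs ys assms(3) by auto
qed

lemma surely_greater_2:
  assumes "surely_greater [s1, s2] [t1, t2]" "a \<le> b"
    and "compatible a b s1 x1" "compatible a b s2 x2" "compatible a b t1 y1" "compatible a b t2 y2"
  shows "y1 + y2 < x1 + x2"
  using surely_greater_sum_list[OF assms(1,2), of "[x1, x2]" "[y1, y2]"] assms(3-) by simp

lemma surely_greater_3:
  assumes "surely_greater [s1, s2, s3] [t1, t2, t3]" "a \<le> b"
    and "compatible a b s1 x1" "compatible a b s2 x2" "compatible a b s3 x3"
    and "compatible a b t1 y1" "compatible a b t2 y2" "compatible a b t3 y3"
  shows "y1 + y2 + y3 < x1 + x2 + x3"
  using surely_greater_sum_list[OF assms(1,2), of "[x1, x2, x3]" "[y1, y2, y3]"] assms(3-)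
  by (simp add: add.assoc)

text \<open>The first three comparisons are with transpositions, the last two with 3-cycles. A
  transposition shares one diagonal entry with the identity. This entry is cancelled, since
  otherwise an adjacent pair on both sides would have to be outweighed by a far one.\<close>

definition unique_maximum :: "status \<times> status \<times> status \<Rightarrow> status \<times> status \<times> status \<Rightarrow>
    status \<times> status \<times> status \<Rightarrow> bool" where
  "unique_maximum r1 r2 r3 = (case (r1, r2, r3) of
     ((s11, s12, s13), (s21, s22, s23), (s31, s32, s33)) \<Rightarrow>
       surely_greater [s11, s22] [s12, s21] \<and>
       surely_greater [s11, s33] [s13, s31] \<and>
       surely_greater [s22, s33] [s23, s32] \<and>
       surely_greater [s11, s22, s33] [s12, s23, s31] \<and>
       surely_greater [s11, s22, s33] [s13, s21, s32])"

section \<open>Checking refutations by unit propagation\<close>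

text \<open>\<open>Minor\<close> refers to a 3 by 3 minor whose main diagonal would be a unique maximum, \<open>Previous\<close> to
  the image of an earlier clause under a symmetry of the cube. A refutation starts from the negated
  clause and adds literals by unit propagation.\<close>

datatype reason = Minor "point \<times> point \<times> point" "point \<times> point \<times> point" | Previous nat cube_symmetry

fun contradicts :: "literal list list \<Rightarrow> literal list \<Rightarrow> reason \<Rightarrow> bool" where
  "contradicts Ls A (Minor (u1, u2, u3) (v1, v2, v3)) \<longleftrightarrow>
     list_all in_cube [u1, u2, u3, v1, v2, v3] \<and>
     unique_maximum (status A u1 v1, status A u1 v2, status A u1 v3)
       (status A u2 v1, status A u2 v2, status A u2 v3)
       (status A u3 v1, status A u3 v2, status A u3 v3)"
| "contradicts Ls A (Previous i \<sigma>) \<longleftrightarrow> i < length Ls \<and>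
     list_all (\<lambda>l. List.member A (negate (act_literal \<sigma> l))) (Ls ! i)"

fun refutes :: "literal list list \<Rightarrow> literal list \<Rightarrow> (literal \<times> reason) list \<Rightarrow> reason \<Rightarrow> bool" where
  "refutes Ls A [] r \<longleftrightarrow> contradicts Ls A r"
| "refutes Ls A ((l, r') # ps) r \<longleftrightarrow>
     nonadjacent l \<and> contradicts Ls (negate l # A) r' \<and> refutes Ls (l # A) ps r"

type_synonym certificate = "(literal list \<times> (literal \<times> reason) list \<times> reason) list"

fun certifies :: "literal list list \<Rightarrow> certificate \<Rightarrow> bool" where
  "certifies Ls [] \<longleftrightarrow> List.member Ls []"
| "certifies Ls ((C, ps, r) # cs) \<longleftrightarrow>
     list_all nonadjacent C \<and> refutes Ls (map negate C) ps r \<and> certifies (Ls @ [C]) cs"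

text \<open>The quantifier over all \<open>D\<close>, with \<open>a\<close> and \<open>b\<close>
  fixed, makes validity invariant under symmetry: a clause applied to transformed distances yields
  its image for the original ones.\<close>

definition valid_clause :: "real \<Rightarrow> real \<Rightarrow> literal list \<Rightarrow> bool" where
  "valid_clause a b C \<longleftrightarrow> (\<forall>D. cube_model a b D \<longrightarrow> (\<exists>l\<in>set C. holds a b D l))"

lemma compatible_status:
  assumes "cube_model a b D" "list_all (holds a b D) A" "in_cube u" "in_cube v"
  shows "compatible a b (status A u v) (D u v)"
proof -
  have "grid3_adj u v \<Longrightarrow> u \<noteq> v" by (cases u; cases v) auto
  then have "grid3_adj u v \<Longrightarrow> a \<le> D u v \<and> D u v \<le> b"
    using cube_modelD[OF assms(1,3,4)] by simp
  moreover have "(u, v, True) \<in> set A \<Longrightarrow> b < D u v" "(u, v, False) \<in> set A \<Longrightarrow> D u v < a"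
    using assms(2) by (auto simp: list_all_iff)
  ultimately show ?thesis by (simp add: status_def List.member_iff)
qed

lemma contradicts_sound:
  assumes M: "cube_model a b D" and A: "list_all (holds a b D) A"
    and L: "\<forall>C\<in>set Ls. valid_clause a b C" and c: "contradicts Ls A r"
  shows False
proof (cases r)
  case (Minor us vs)
  obtain u1 u2 u3 v1 v2 v3 where us: "us = (u1, u2, u3)" "vs = (v1, v2, v3)"
    by (cases us; cases vs) auto
  have ab: "a \<le> b" and sing: "minors_singular cube D" using M by (auto simp: cube_model_def)
  have inc: "in_cube u1" "in_cube u2" "in_cube u3" "in_cube v1" "in_cube v2" "in_cube v3"
    using c Minor us by simp_all
  note comp = compatible_status[OF M A]
  have um: "surely_greater [status A u1 v1, status A u2 v2] [status A u1 v2, status A u2 v1]"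
    "surely_greater [status A u1 v1, status A u3 v3] [status A u1 v3, status A u3 v1]"
    "surely_greater [status A u2 v2, status A u3 v3] [status A u2 v3, status A u3 v2]"
    "surely_greater [status A u1 v1, status A u2 v2, status A u3 v3]
       [status A u1 v2, status A u2 v3, status A u3 v1]"
    "surely_greater [status A u1 v1, status A u2 v2, status A u3 v3]
       [status A u1 v3, status A u2 v1, status A u3 v2]"
    using c Minor us by (simp_all add: unique_maximum_def)
  have "D u1 v2 + D u2 v1 < D u1 v1 + D u2 v2"
    by (rule surely_greater_2[OF um(1) ab]; rule comp; rule inc)
  moreover have "D u1 v3 + D u3 v1 < D u1 v1 + D u3 v3"
    by (rule surely_greater_2[OF um(2) ab]; rule comp; rule inc)
  moreover have "D u2 v3 + D u3 v2 < D u2 v2 + D u3 v3"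
    by (rule surely_greater_2[OF um(3) ab]; rule comp; rule inc)
  moreover have "D u1 v2 + D u2 v3 + D u3 v1 < D u1 v1 + D u2 v2 + D u3 v3"
    by (rule surely_greater_3[OF um(4) ab]; rule comp; rule inc)
  moreover have "D u1 v3 + D u2 v1 + D u3 v2 < D u1 v1 + D u2 v2 + D u3 v3"
    by (rule surely_greater_3[OF um(5) ab]; rule comp; rule inc)
  moreover note sing[unfolded minors_singular_def, rule_format, OF inc[unfolded in_cube_iff]]
  ultimately show False by (elim disjE) linarith+
next
  case (Previous i \<sigma>)
  then have "valid_clause a b (Ls ! i)" using c L by simp
  \<comment> \<open>Clause \<open>i\<close> is applied to \<open>D\<close> transformed by
    \<open>\<sigma>\<close>; the literal that holds there is the image literal for
    \<open>D\<close>.\<close>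
  then obtain l where l: "l \<in> set (Ls ! i)" "holds a b D (act_literal \<sigma> l)"
    using cube_model_act[OF M, of \<sigma>] unfolding valid_clause_def holds_act[symmetric] by blast
  have "holds a b D (negate (act_literal \<sigma> l))"
    using c Previous A l(1) by (simp add: list_all_iff List.member_iff)
  moreover have "a \<le> b" using M by (simp add: cube_model_def)
  ultimately show False using l(2) by (cases "act_literal \<sigma> l") (simp split: if_splits)
qed

lemma refutes_sound:
  assumes "cube_model a b D" "\<forall>C\<in>set Ls. valid_clause a b C"
  shows "refutes Ls A ps r \<Longrightarrow> list_all (holds a b D) A \<Longrightarrow> False"
proof (induction ps arbitrary: A)
  case Nil
  then show ?case using contradicts_sound[OF assms(1) Nil.prems(2) assms(2)] by simp
next
  case (Cons p ps)
  obtain l r' where p: "p = (l, r')" by (cases p)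
  have "holds a b D l"
  proof (rule ccontr)
    assume "\<not> holds a b D l"
    then have "list_all (holds a b D) (negate l # A)"
      using holds_negate assms(1) Cons.prems p by simp
    from contradicts_sound[OF assms(1) this assms(2), of r'] show False using Cons.prems p by simp
  qed
  then show ?case using Cons.IH[of "l # A"] Cons.prems p by simp
qed

lemma certifies_sound:
  assumes "certifies Ls cs" "\<forall>C\<in>set Ls. valid_clause a b C"
  shows "\<not> cube_model a b D"
  using assms
proof (induction cs arbitrary: Ls)
  case Nil
  then have "valid_clause a b []" by (simp add: List.member_iff)
  then show ?case by (auto simp: valid_clause_def)
next
  case (Cons c cs)
  obtain C ps r where c: "c = (C, ps, r)" by (cases c)
  have "valid_clause a b C"
    unfolding valid_clause_def
  proof (intro allI impI, rule ccontr)
    fix D' assume M: "cube_model a b D'" and "\<not> (\<exists>l\<in>set C. holds a b D' l)"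
    then have "list_all (holds a b D') (map negate C)"
      using Cons.prems(1) c holds_negate by (auto simp: list_all_iff)
    from refutes_sound[OF M Cons.prems(2) _ this, of ps r] show False using Cons.prems(1) c by simp
  qed
  then show ?case using Cons.IH[of "Ls @ [C]"] Cons.prems c by simp
qed

text \<open>Found by a SAT solver with conflict-driven clause learning, in which every learned clause was
  added together with its images under the 48 symmetries of the cube.\<close>

definition cube_certificate :: certificate where
  "cube_certificate = [
  ([((-1,-1,-1),(1,0,1),True), ((1,0,0),(0,-1,1),True), ((-1,-1,-1),(1,-1,0),False), ((-1,-1,-1),(0,0,0),True), ((-1,-1,-1),(0,-1,1),True)],
   [(((0,-1,0),(1,0,1),True), Minor ((-1,-1,-1),(0,-1,0),(1,0,0)) ((1,-1,0),(0,-1,1),(1,0,1))),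
    (((1,-1,1),(0,0,0),False), Minor ((-1,-1,-1),(0,-1,0),(1,-1,1)) ((1,-1,0),(1,0,1),(0,0,0)))],
   Minor ((-1,-1,-1),(1,-1,1),(1,0,0)) ((1,-1,0),(0,-1,1),(0,0,0))),
  ([((-1,-1,-1),(1,0,1),False), ((-1,-1,-1),(1,-1,0),True), ((-1,-1,-1),(0,0,0),True), ((1,0,0),(0,-1,1),True), ((-1,-1,-1),(0,-1,1),True)],
   [(((0,0,1),(1,-1,0),True), Minor ((-1,-1,-1),(0,0,1),(1,0,0)) ((1,0,1),(0,-1,1),(1,-1,0))),
    (((1,-1,1),(0,0,0),False), Minor ((-1,-1,-1),(0,0,1),(1,-1,1)) ((1,0,1),(1,-1,0),(0,0,0)))],
   Minor ((-1,-1,-1),(1,-1,1),(1,0,0)) ((1,0,1),(0,-1,1),(0,0,0))),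
  ([((1,0,0),(-1,0,1),False), ((-1,0,0),(0,-1,1),True), ((-1,0,0),(0,-1,-1),True), ((1,0,0),(-1,-1,0),True), ((1,0,0),(0,-1,1),True), ((0,0,-1),(-1,-1,0),True)],
   [(((-1,0,0),(1,0,1),False), Minor ((-1,0,0),(1,0,0),(0,0,1)) ((1,0,1),(-1,0,1),(0,-1,1))),
    (((0,0,1),(-1,-1,0),True), Minor ((-1,0,0),(0,0,1),(1,0,0)) ((-1,-1,0),(0,-1,1),(-1,0,1))),
    (((0,0,-1),(0,-1,1),False), Minor ((0,0,-1),(0,0,1),(1,0,0)) ((0,-1,1),(-1,-1,0),(0,0,0))),
    (((0,0,-1),(-1,0,1),True), Minor ((0,0,-1),(0,0,1),(1,0,0)) ((0,0,0),(-1,-1,0),(-1,0,1))),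
    (((-1,-1,1),(0,0,0),False), Minor ((-1,-1,1),(0,0,1),(1,0,0)) ((0,0,0),(-1,-1,0),(-1,0,1))),
    (((-1,-1,1),(1,0,1),False), Minor ((-1,-1,1),(0,0,1),(1,0,0)) ((1,0,1),(-1,-1,0),(-1,0,1))),
    (((0,-1,0),(1,0,1),False), Minor ((-1,-1,1),(-1,0,0),(0,-1,0)) ((0,-1,1),(0,0,0),(1,0,1))),
    (((-1,0,0),(1,-1,0),False), Minor ((-1,0,0),(0,-1,0),(1,0,0)) ((1,-1,0),(0,-1,1),(1,0,1))),
    (((0,0,-1),(1,0,1),False), Minor ((-1,-1,1),(-1,0,0),(0,0,-1)) ((0,-1,1),(0,0,0),(1,0,1))),
    (((0,0,-1),(1,-1,0),False), Minor ((0,-1,0),(0,0,-1),(1,0,0)) ((-1,-1,0),(1,-1,0),(1,0,1))),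
    (((-1,-1,1),(1,-1,0),False), Minor ((-1,-1,1),(-1,0,0),(0,0,-1)) ((1,-1,0),(-1,-1,0),(-1,0,1))),
    (((1,0,0),(0,-1,-1),True), Minor ((-1,0,0),(0,0,-1),(1,0,0)) ((-1,-1,0),(0,-1,-1),(1,0,1))),
    (((-1,-1,1),(0,-1,-1),True), Minor ((-1,-1,1),(-1,0,0),(1,0,0)) ((0,-1,1),(0,0,0),(0,-1,-1))),
    (((1,-1,-1),(0,0,0),True), Minor ((-1,-1,1),(-1,0,0),(1,-1,-1)) ((0,-1,-1),(0,0,0),(1,-1,0))),
    (((1,-1,-1),(1,0,1),False), Minor ((-1,-1,1),(0,-1,0),(1,-1,-1)) ((0,-1,-1),(1,-1,0),(1,0,1))),
    (((-1,-1,1),(1,0,-1),False), Minor ((-1,-1,1),(1,-1,-1),(1,0,0)) ((1,0,-1),(0,0,0),(1,0,1)))],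
   Previous 0 (ZYX,False,False,True)),
  ([((-1,1,1),(-1,-1,0),True), ((1,0,0),(-1,1,0),False), ((-1,-1,-1),(0,0,0),True), ((-1,-1,-1),(-1,0,1),True), ((1,0,0),(-1,-1,0),True), ((0,0,-1),(-1,-1,0),True), ((1,0,0),(0,-1,-1),False), ((1,0,0),(-1,0,1),True)],
   [(((-1,1,1),(0,-1,-1),True), Minor ((-1,-1,-1),(-1,1,1),(1,0,0)) ((-1,-1,0),(-1,0,1),(0,-1,-1))),
    (((-1,1,1),(0,0,0),True), Minor ((-1,-1,-1),(-1,1,1),(0,0,-1)) ((-1,-1,0),(0,-1,-1),(0,0,0)))],
   Minor ((-1,1,1),(1,0,0),(-1,0,0)) ((0,0,0),(-1,1,0),(-1,-1,0))),
  ([((0,-1,0),(-1,0,1),True), ((1,0,0),(0,-1,1),False), ((0,0,-1),(-1,0,1),True), ((1,0,0),(0,-1,-1),False), ((0,0,-1),(-1,-1,0),True), ((1,0,0),(-1,0,1),True), ((1,0,0),(-1,-1,0),True)],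
   [(((0,-1,0),(1,0,1),False), Minor ((0,-1,0),(1,0,0),(0,0,1)) ((1,0,1),(0,-1,1),(-1,0,1))),
    (((0,0,-1),(1,0,1),False), Minor ((0,-1,0),(0,0,-1),(1,0,0)) ((-1,-1,0),(1,0,1),(0,-1,-1))),
    (((0,0,1),(-1,-1,0),True), Minor ((0,-1,0),(0,0,1),(1,0,0)) ((-1,-1,0),(-1,0,1),(0,-1,1))),
    (((0,0,-1),(0,-1,1),True), Minor ((0,0,-1),(0,0,1),(1,0,0)) ((0,0,0),(-1,-1,0),(0,-1,1))),
    (((-1,-1,1),(1,0,1),False), Minor ((-1,-1,1),(0,0,1),(1,0,0)) ((1,0,1),(-1,-1,0),(0,-1,1))),
    (((0,0,-1),(1,-1,0),False), Minor ((0,0,-1),(1,0,0),(0,-1,0)) ((1,-1,0),(0,-1,-1),(-1,-1,0))),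
    (((-1,-1,1),(1,-1,0),False), Minor ((-1,-1,1),(0,0,-1),(1,-1,1)) ((1,-1,0),(0,-1,1),(1,0,1))),
    (((0,0,1),(1,-1,0),False), Minor ((-1,-1,1),(0,0,-1),(0,0,1)) ((-1,0,1),(0,-1,1),(1,-1,0)))],
   Minor ((0,0,-1),(0,0,1),(0,-1,0)) ((0,-1,1),(-1,-1,0),(1,-1,0))),
  ([((0,-1,0),(-1,0,1),False), ((1,0,0),(0,-1,1),False), ((1,0,0),(0,-1,-1),False), ((0,0,-1),(-1,-1,0),True), ((-1,-1,-1),(0,0,0),True), ((1,0,0),(-1,0,1),True), ((1,0,0),(-1,-1,0),True)],
   [(((0,0,1),(-1,-1,0),False), Minor ((0,-1,0),(0,0,1),(1,0,0)) ((-1,0,1),(-1,-1,0),(0,0,0))),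
    (((-1,-1,-1),(-1,0,1),True), Minor ((-1,-1,-1),(0,-1,0),(1,0,0)) ((-1,-1,0),(-1,0,1),(0,-1,-1))),
    (((-1,-1,1),(0,0,0),False), Minor ((-1,-1,1),(0,-1,0),(1,0,0)) ((0,0,0),(-1,0,1),(0,-1,1))),
    (((-1,-1,1),(1,-1,0),False), Minor ((-1,-1,1),(0,-1,0),(1,0,0)) ((1,-1,0),(-1,0,1),(0,-1,1))),
    (((0,0,-1),(1,-1,0),False), Minor ((0,0,-1),(1,0,0),(0,-1,0)) ((1,-1,0),(0,-1,-1),(-1,-1,0))),
    (((0,0,-1),(-1,0,1),False), Minor ((-1,-1,1),(0,0,-1),(1,0,0)) ((-1,-1,0),(-1,0,1),(1,-1,0))),
    (((0,0,-1),(0,-1,1),True), Minor ((0,-1,0),(0,0,-1),(1,0,0)) ((-1,0,1),(0,0,0),(0,-1,1))),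
    (((-1,-1,1),(0,-1,-1),False), Minor ((-1,-1,-1),(-1,-1,1),(0,0,-1)) ((-1,0,1),(0,-1,-1),(0,0,0))),
    (((0,0,1),(0,-1,-1),False), Minor ((-1,-1,1),(0,0,-1),(0,0,1)) ((-1,-1,0),(0,-1,1),(0,-1,-1))),
    (((-1,-1,1),(1,0,1),True), Minor ((-1,-1,1),(0,0,1),(1,0,0)) ((-1,-1,0),(1,0,1),(0,-1,-1)))],
   Minor ((-1,-1,1),(0,0,1),(1,0,0)) ((1,0,1),(0,0,0),(0,-1,-1))),
  ([((1,0,0),(0,-1,1),False), ((1,0,0),(0,-1,-1),False), ((0,0,-1),(-1,-1,0),True), ((-1,-1,-1),(0,0,0),True), ((1,0,0),(-1,0,1),True), ((1,0,0),(-1,-1,0),True)],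
   [(((0,-1,0),(-1,0,1),False), Previous 5 (XYZ,False,False,False)),
    (((0,0,-1),(-1,0,1),True), Previous 4 (XYZ,False,False,False))],
   Minor ((0,-1,0),(0,0,-1),(1,0,0)) ((-1,-1,0),(-1,0,1),(0,-1,-1))),
  ([((0,0,1),(-1,-1,0),False), ((0,-1,0),(-1,0,1),True), ((1,0,0),(0,-1,-1),False), ((0,0,-1),(-1,-1,0),True), ((-1,-1,-1),(0,0,0),True), ((1,0,0),(-1,0,1),True), ((1,0,0),(-1,-1,0),True)],
   [(((1,0,0),(0,-1,1),False), Previous 6 (XYZ,False,False,False)),
    (((-1,-1,-1),(0,-1,1),False), Minor ((-1,-1,-1),(0,0,1),(1,0,0)) ((0,-1,1),(-1,-1,0),(0,0,0))),
    (((-1,-1,-1),(1,-1,0),False), Minor ((-1,-1,-1),(1,0,0),(0,-1,0)) ((1,-1,0),(0,-1,-1),(0,-1,1))),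
    (((-1,-1,-1),(1,0,1),False), Previous 1 (XYZ,False,False,False)),
    (((0,0,-1),(1,0,1),False), Minor ((-1,-1,-1),(0,0,-1),(1,0,0)) ((-1,-1,0),(1,0,1),(0,-1,-1))),
    (((-1,0,0),(1,0,1),False), Minor ((-1,0,0),(0,0,-1),(0,0,1)) ((1,0,1),(0,0,0),(-1,-1,0))),
    (((0,-1,0),(1,0,1),False), Minor ((-1,-1,-1),(0,-1,0),(0,0,-1)) ((-1,-1,0),(1,0,1),(0,0,0))),
    (((-1,0,0),(0,-1,1),True), Minor ((-1,0,0),(0,-1,0),(1,0,0)) ((-1,0,1),(0,-1,1),(1,0,1)))],
   Minor ((-1,0,0),(0,0,1),(1,0,0)) ((0,-1,1),(-1,-1,0),(0,0,0))),
  ([((1,0,0),(-1,1,0),False), ((0,0,1),(-1,-1,0),True), ((0,0,-1),(-1,0,1),True), ((-1,-1,-1),(-1,0,1),True), ((-1,-1,-1),(0,0,0),True), ((1,0,0),(0,-1,-1),False), ((0,0,-1),(-1,-1,0),True), ((1,0,0),(-1,0,1),True), ((1,0,0),(-1,-1,0),True)],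
   [(((-1,1,1),(-1,-1,0),True), Previous 3 (XYZ,False,False,False)),
    (((0,0,-1),(0,1,1),False), Minor ((-1,1,1),(0,0,-1),(0,0,1)) ((-1,-1,0),(0,1,1),(-1,0,1))),
    (((1,0,0),(0,1,1),False), Minor ((-1,1,1),(0,0,1),(1,0,0)) ((-1,-1,0),(-1,0,1),(0,1,1))),
    (((0,1,0),(-1,-1,0),True), Minor ((-1,1,1),(0,1,0),(1,0,0)) ((-1,-1,0),(0,1,1),(-1,1,0))),
    (((0,0,1),(0,1,-1),True), Minor ((0,0,-1),(0,0,1),(0,1,0)) ((0,1,-1),(0,1,1),(-1,-1,0))),
    (((0,0,-1),(-1,1,0),True), Minor ((0,0,-1),(0,1,0),(1,0,0)) ((0,0,0),(-1,-1,0),(-1,1,0))),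
    (((-1,0,0),(0,1,-1),False), Minor ((-1,0,0),(0,0,-1),(0,1,0)) ((0,1,-1),(-1,1,0),(-1,-1,0))),
    (((0,0,1),(-1,1,0),True), Minor ((-1,1,1),(0,0,1),(1,0,0)) ((-1,-1,0),(-1,0,1),(-1,1,0))),
    (((-1,0,0),(0,1,1),False), Minor ((-1,0,0),(-1,1,1),(0,0,1)) ((0,1,1),(-1,-1,0),(-1,1,0))),
    (((0,1,0),(-1,0,1),True), Minor ((-1,0,0),(0,1,0),(1,0,0)) ((-1,0,1),(0,1,1),(-1,1,0))),
    (((-1,1,1),(0,1,-1),False), Minor ((-1,1,1),(0,0,-1),(0,1,0)) ((0,1,-1),(-1,1,0),(-1,0,1))),
    (((1,0,0),(0,1,-1),True), Minor ((0,0,1),(0,1,0),(1,0,0)) ((0,1,-1),(-1,0,1),(0,0,0))),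
    (((-1,1,1),(0,0,0),True), Minor ((-1,0,0),(-1,1,1),(1,0,0)) ((0,0,0),(-1,-1,0),(0,1,-1)))],
   Minor ((-1,1,1),(0,1,0),(1,0,0)) ((0,0,0),(-1,0,1),(-1,1,0))),
  ([((-1,0,0),(0,-1,1),False), ((1,0,0),(-1,1,0),True), ((0,0,1),(-1,-1,0),True), ((0,0,-1),(-1,0,1),True), ((-1,-1,-1),(-1,0,1),True), ((0,-1,0),(-1,0,1),True), ((-1,-1,-1),(0,0,0),True), ((1,0,0),(0,-1,1),True), ((1,0,0),(0,-1,-1),False), ((0,0,-1),(-1,-1,0),True), ((1,0,0),(-1,-1,0),True)],
   [(((0,-1,0),(-1,1,0),False), Minor ((-1,0,0),(0,-1,0),(1,0,0)) ((0,-1,1),(-1,1,0),(0,0,0))),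
    (((-1,-1,-1),(-1,1,0),False), Minor ((-1,-1,-1),(0,-1,0),(1,0,0)) ((-1,1,0),(-1,-1,0),(0,-1,-1))),
    (((0,0,1),(-1,1,0),False), Minor ((-1,0,0),(0,0,1),(1,0,0)) ((0,-1,1),(-1,1,0),(0,0,0))),
    (((-1,-1,-1),(0,1,1),False), Previous 1 (YZX,False,False,False)),
    (((-1,-1,1),(-1,1,0),False), Minor ((-1,-1,1),(0,-1,0),(0,0,1)) ((-1,1,0),(-1,-1,0),(-1,0,1))),
    (((-1,-1,-1),(0,-1,1),True), Minor ((-1,-1,-1),(-1,0,0),(1,0,0)) ((-1,-1,0),(0,-1,1),(0,0,0))),
    (((-1,-1,1),(0,0,0),True), Minor ((-1,-1,-1),(-1,-1,1),(0,-1,0)) ((0,-1,1),(-1,0,1),(0,0,0))),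
    (((0,1,0),(0,-1,1),True), Minor ((-1,-1,-1),(-1,-1,1),(0,1,0)) ((0,-1,1),(0,0,0),(-1,1,0))),
    (((0,0,-1),(0,-1,1),False), Minor ((0,0,-1),(1,0,0),(0,-1,0)) ((0,-1,1),(0,-1,-1),(-1,-1,0))),
    (((1,0,0),(-1,0,-1),True), Minor ((-1,-1,-1),(0,0,-1),(1,0,0)) ((0,-1,1),(-1,0,-1),(0,-1,-1))),
    (((-1,1,-1),(-1,-1,0),True), Minor ((-1,-1,-1),(-1,1,-1),(1,0,0)) ((-1,-1,0),(-1,1,0),(-1,0,-1))),
    (((1,0,0),(0,1,-1),True), Minor ((-1,1,-1),(0,0,-1),(1,0,0)) ((-1,-1,0),(0,1,-1),(-1,0,-1))),
    (((0,1,0),(-1,-1,0),True), Minor ((-1,1,-1),(0,1,0),(1,0,0)) ((-1,-1,0),(-1,1,0),(0,1,-1))),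
    (((0,0,-1),(1,1,0),False), Minor ((0,0,-1),(0,1,0),(1,0,0)) ((1,1,0),(0,-1,1),(0,1,-1))),
    (((0,0,1),(1,1,0),False), Minor ((0,0,-1),(0,0,1),(0,1,0)) ((0,0,0),(1,1,0),(-1,-1,0))),
    (((1,0,0),(0,1,1),True), Minor ((0,0,1),(0,1,0),(1,0,0)) ((0,1,1),(-1,-1,0),(1,1,0))),
    (((0,0,-1),(0,1,1),True), Minor ((-1,-1,-1),(0,0,-1),(1,0,0)) ((-1,-1,0),(0,0,0),(0,1,1))),
    (((0,0,-1),(-1,1,0),True), Previous 2 (YZX,False,False,True))],
   Minor ((-1,0,0),(0,0,-1),(1,0,0)) ((0,-1,1),(-1,1,0),(0,0,0))),
  ([((-1,-1,-1),(1,-1,0),True), ((0,0,1),(-1,-1,0),True), ((-1,-1,-1),(-1,0,1),True), ((-1,-1,-1),(0,0,0),True), ((0,0,-1),(1,-1,0),True), ((0,0,-1),(-1,-1,0),True), ((1,0,0),(-1,0,1),True), ((1,0,0),(-1,-1,0),True)],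
   [(((0,0,1),(1,-1,0),False), Minor ((-1,-1,-1),(0,0,-1),(0,0,1)) ((-1,-1,0),(0,0,0),(1,-1,0)))],
   Minor ((-1,-1,-1),(0,0,1),(1,0,0)) ((-1,-1,0),(-1,0,1),(1,-1,0))),
  ([((0,-1,0),(-1,0,1),True), ((-1,-1,-1),(0,0,0),True), ((1,0,0),(0,-1,1),True), ((1,0,0),(0,-1,-1),False), ((0,0,-1),(-1,-1,0),True), ((1,0,0),(-1,0,1),True), ((1,0,0),(-1,-1,0),True)],
   [(((0,0,1),(-1,-1,0),False), Previous 7 (XYZ,False,False,False)),
    (((0,0,-1),(-1,0,1),False), Minor ((0,-1,0),(0,0,-1),(1,0,0)) ((-1,-1,0),(-1,0,1),(0,-1,-1))),
    (((-1,-1,-1),(-1,0,1),False), Minor ((-1,-1,-1),(0,-1,0),(1,0,0)) ((-1,0,1),(-1,-1,0),(0,-1,-1))),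
    (((1,0,0),(-1,1,0),False), Previous 8 (XYZ,False,False,False)),
    (((-1,0,0),(0,-1,1),False), Previous 9 (XYZ,False,False,False)),
    (((0,0,-1),(0,-1,1),False), Minor ((0,0,-1),(1,0,0),(0,-1,0)) ((0,-1,1),(0,-1,-1),(-1,-1,0))),
    (((0,0,-1),(1,-1,0),False), Minor ((0,0,-1),(1,0,0),(0,-1,0)) ((1,-1,0),(0,-1,-1),(-1,-1,0))),
    (((-1,-1,-1),(1,-1,0),True), Previous 10 (XYZ,False,False,False)),
    (((-1,-1,-1),(0,-1,1),True), Minor ((-1,-1,-1),(1,0,0),(0,-1,0)) ((1,-1,0),(0,-1,-1),(0,-1,1))),
    (((1,0,0),(-1,0,-1),False), Minor ((-1,-1,-1),(-1,0,0),(1,0,0)) ((0,-1,1),(-1,0,1),(-1,0,-1)))],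
   Minor ((-1,-1,-1),(0,0,-1),(1,0,0)) ((0,-1,1),(-1,0,-1),(0,-1,-1))),
  ([((0,-1,0),(-1,0,1),False), ((0,0,-1),(0,-1,1),True), ((1,0,0),(0,-1,1),True), ((0,0,-1),(1,-1,0),True), ((0,0,-1),(-1,-1,0),True), ((1,0,0),(-1,0,1),True), ((1,0,0),(-1,-1,0),True)],
   [(((-1,0,0),(0,-1,1),False), Minor ((-1,0,0),(0,-1,0),(1,0,0)) ((0,-1,1),(-1,0,1),(0,0,0))),
    (((0,0,1),(-1,-1,0),False), Minor ((0,-1,0),(0,0,1),(1,0,0)) ((-1,0,1),(-1,-1,0),(0,0,0))),
    (((0,0,-1),(-1,0,1),False), Minor ((-1,0,0),(0,0,-1),(0,0,1)) ((-1,-1,0),(-1,0,1),(0,-1,1))),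
    (((-1,0,0),(1,-1,0),False), Minor ((-1,0,0),(0,-1,0),(0,0,-1)) ((1,-1,0),(-1,0,1),(0,0,0))),
    (((0,0,1),(1,-1,0),True), Minor ((-1,0,0),(0,0,1),(1,0,0)) ((-1,-1,0),(0,-1,1),(1,-1,0)))],
   Minor ((0,-1,0),(0,0,-1),(0,0,1)) ((-1,0,1),(0,0,0),(1,-1,0))),
  ([((1,0,0),(0,-1,1),True), ((1,0,0),(0,-1,-1),False), ((0,0,-1),(-1,-1,0),True), ((1,0,0),(-1,0,1),True), ((1,0,0),(-1,-1,0),True)],
   [(((0,0,-1),(0,-1,1),False), Minor ((0,0,-1),(1,0,0),(0,-1,0)) ((0,-1,1),(0,-1,-1),(-1,-1,0))),
    (((0,0,-1),(1,-1,0),False), Minor ((0,0,-1),(1,0,0),(0,-1,0)) ((1,-1,0),(0,-1,-1),(-1,-1,0))),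
    (((0,-1,0),(-1,0,1),False), Previous 12 (XYZ,False,False,False)),
    (((-1,-1,-1),(0,0,0),True), Previous 11 (XYZ,False,False,False)),
    (((-1,-1,-1),(0,-1,1),True), Minor ((-1,-1,-1),(1,0,0),(0,-1,0)) ((0,0,0),(0,-1,-1),(0,-1,1))),
    (((1,0,0),(-1,0,-1),True), Minor ((-1,-1,-1),(0,0,-1),(1,0,0)) ((0,-1,1),(-1,0,-1),(0,-1,-1))),
    (((-1,-1,-1),(-1,0,1),True), Minor ((-1,-1,-1),(1,0,0),(-1,0,0)) ((0,0,0),(-1,0,-1),(-1,0,1)))],
   Minor ((-1,-1,-1),(0,-1,0),(1,0,0)) ((-1,0,1),(-1,-1,0),(0,-1,-1))),
  ([((0,-1,0),(-1,0,1),True), ((1,0,0),(0,-1,1),False), ((1,0,0),(-1,0,1),True), ((0,0,-1),(-1,-1,0),True), ((1,0,0),(-1,-1,0),True)],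
   [(((0,-1,0),(1,0,1),False), Minor ((0,-1,0),(1,0,0),(0,0,1)) ((1,0,1),(0,-1,1),(-1,0,1))),
    (((0,0,1),(-1,-1,0),True), Minor ((0,-1,0),(0,0,1),(1,0,0)) ((-1,-1,0),(-1,0,1),(0,-1,1))),
    (((-1,-1,1),(0,0,0),False), Minor ((-1,-1,1),(0,0,1),(1,0,0)) ((0,0,0),(-1,-1,0),(0,-1,1))),
    (((-1,-1,1),(1,0,1),False), Minor ((-1,-1,1),(0,0,1),(1,0,0)) ((1,0,1),(-1,-1,0),(0,-1,1))),
    (((0,0,-1),(-1,0,1),False), Minor ((0,0,-1),(0,0,1),(1,0,0)) ((-1,0,1),(-1,-1,0),(0,0,0))),
    (((0,0,-1),(1,0,1),False), Minor ((-1,-1,1),(0,-1,0),(0,0,-1)) ((-1,0,1),(0,0,0),(1,0,1))),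
    (((0,0,-1),(1,-1,0),False), Minor ((0,-1,0),(0,0,-1),(1,0,0)) ((-1,-1,0),(1,-1,0),(1,0,1))),
    (((0,0,-1),(0,-1,1),True), Minor ((0,0,-1),(0,0,1),(1,0,0)) ((0,0,0),(-1,-1,0),(0,-1,1))),
    (((1,-1,1),(-1,0,1),False), Minor ((0,-1,0),(0,0,-1),(1,-1,1)) ((1,-1,0),(0,-1,1),(-1,0,1)))],
   Minor ((-1,-1,1),(0,0,-1),(1,-1,1)) ((-1,0,1),(0,-1,1),(1,0,1))),
  ([((1,0,0),(0,-1,1),False), ((1,0,0),(-1,0,1),True), ((0,0,-1),(-1,-1,0),True), ((1,0,0),(-1,-1,0),True)],
   [(((0,-1,0),(-1,0,1),True), Previous 14 (XYZ,False,False,False)),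
    (((0,0,1),(1,-1,0),False), Minor ((0,-1,0),(0,0,1),(1,0,0)) ((-1,0,1),(1,-1,0),(0,-1,1))),
    (((-1,-1,1),(0,0,0),False), Minor ((-1,-1,1),(0,-1,0),(1,0,0)) ((0,0,0),(-1,0,1),(0,-1,1))),
    (((-1,-1,1),(1,-1,0),False), Minor ((-1,-1,1),(0,-1,0),(1,0,0)) ((1,-1,0),(-1,0,1),(0,-1,1))),
    (((0,0,1),(-1,-1,0),False), Minor ((0,-1,0),(0,0,1),(1,0,0)) ((-1,0,1),(-1,-1,0),(0,0,0))),
    (((0,0,-1),(1,-1,0),False), Minor ((-1,-1,1),(0,0,-1),(0,0,1)) ((-1,-1,0),(1,-1,0),(0,0,0))),
    (((0,0,-1),(-1,0,1),False), Minor ((-1,-1,1),(0,0,-1),(1,0,0)) ((-1,-1,0),(-1,0,1),(1,-1,0))),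
    (((0,0,-1),(1,0,1),False), Minor ((0,0,-1),(0,0,1),(1,0,0)) ((1,0,1),(-1,0,1),(1,-1,0))),
    (((0,0,-1),(0,-1,1),True), Minor ((0,-1,0),(0,0,-1),(1,0,0)) ((-1,0,1),(0,0,0),(0,-1,1))),
    (((-1,-1,1),(1,0,1),True), Minor ((-1,-1,1),(0,0,-1),(0,0,1)) ((-1,-1,0),(0,-1,1),(1,0,1)))],
   Minor ((-1,-1,1),(0,0,-1),(1,-1,1)) ((1,0,1),(0,-1,1),(1,-1,0))),
  ([((1,0,0),(0,1,-1),False), ((0,0,-1),(0,-1,1),False), ((1,0,0),(-1,0,-1),True), ((-1,0,0),(0,-1,1),True), ((1,0,0),(0,-1,1),True), ((0,0,-1),(-1,-1,0),True), ((1,0,0),(-1,-1,0),True)],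
   [(((-1,1,-1),(-1,-1,0),False), Minor ((-1,1,-1),(0,0,-1),(1,0,0)) ((-1,-1,0),(-1,0,-1),(0,1,-1))),
    (((-1,1,-1),(0,-1,1),True), Minor ((-1,1,-1),(0,0,-1),(1,0,0)) ((-1,0,-1),(0,-1,1),(0,1,-1))),
    (((1,0,0),(-1,1,0),False), Minor ((-1,0,0),(-1,1,-1),(1,0,0)) ((-1,-1,0),(0,-1,1),(-1,1,0))),
    (((0,-1,0),(-1,0,-1),True), Previous 15 (XZY,False,False,False))],
   Minor ((0,-1,0),(0,0,-1),(1,0,0)) ((-1,0,-1),(0,-1,1),(0,0,0))),
  ([((0,-1,0),(-1,0,1),False), ((1,0,0),(-1,0,1),True), ((0,0,-1),(-1,-1,0),True), ((1,0,0),(-1,-1,0),True)],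
   [(((0,0,1),(-1,-1,0),False), Minor ((0,-1,0),(0,0,1),(1,0,0)) ((-1,0,1),(-1,-1,0),(0,0,0))),
    (((1,0,0),(0,-1,1),False), Previous 15 (XYZ,False,False,False)),
    (((-1,0,0),(0,-1,1),False), Minor ((-1,0,0),(0,-1,0),(1,0,0)) ((0,-1,1),(-1,0,1),(0,0,0))),
    (((1,0,0),(0,-1,-1),False), Previous 13 (XYZ,False,False,False)),
    (((0,0,1),(0,-1,-1),False), Minor ((0,-1,0),(0,0,1),(1,0,0)) ((-1,0,1),(0,-1,-1),(0,0,0))),
    (((-1,0,0),(0,-1,-1),False), Minor ((-1,0,0),(0,-1,0),(1,0,0)) ((0,-1,-1),(-1,0,1),(0,0,0))),
    (((0,0,1),(-1,0,-1),False), Minor ((-1,0,0),(0,0,-1),(0,0,1)) ((-1,-1,0),(0,-1,-1),(-1,0,-1))),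
    (((0,0,1),(1,-1,0),False), Previous 13 (ZYX,True,False,False)),
    (((0,0,-1),(0,-1,1),True), Minor ((-1,0,0),(0,0,-1),(0,0,1)) ((-1,-1,0),(0,-1,-1),(0,-1,1))),
    (((0,0,-1),(-1,0,1),True), Minor ((0,-1,0),(0,0,-1),(1,0,0)) ((-1,0,1),(0,-1,1),(0,0,0))),
    (((1,0,0),(-1,0,-1),False), Previous 2 (XYZ,False,False,True)),
    (((1,0,0),(0,1,-1),False), Previous 16 (XYZ,False,False,False)),
    (((0,-1,0),(0,1,-1),False), Minor ((0,-1,0),(0,0,-1),(1,0,0)) ((0,1,-1),(0,-1,1),(0,0,0))),
    (((-1,0,0),(0,1,-1),False), Minor ((-1,0,0),(0,0,-1),(1,0,0)) ((0,1,-1),(-1,0,1),(0,0,0))),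
    (((0,0,1),(0,1,-1),False), Minor ((0,0,-1),(0,0,1),(1,0,0)) ((-1,0,1),(0,1,-1),(0,0,0))),
    (((0,0,1),(-1,1,0),False), Previous 15 (ZYX,True,True,False)),
    (((0,-1,0),(-1,0,-1),False), Minor ((0,-1,0),(0,0,-1),(1,0,0)) ((-1,0,-1),(0,-1,1),(0,0,0))),
    (((0,-1,0),(-1,1,0),True), Previous 13 (YXZ,False,True,True)),
    (((1,0,0),(-1,1,0),True), Minor ((0,-1,0),(0,0,1),(1,0,0)) ((-1,1,0),(0,-1,1),(1,-1,0)))],
   Previous 2 (XZY,False,False,False)),
  ([((0,0,-1),(0,-1,1),False), ((1,0,0),(-1,0,1),True), ((0,0,-1),(-1,-1,0),True), ((1,0,0),(-1,-1,0),True)],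
   [(((0,-1,0),(-1,0,1),False), Previous 17 (XYZ,False,False,False)),
    (((1,0,0),(0,-1,1),False), Previous 15 (XYZ,False,False,False)),
    (((0,0,1),(-1,-1,0),False), Minor ((0,0,-1),(0,0,1),(1,0,0)) ((0,-1,1),(-1,-1,0),(0,0,0))),
    (((0,0,-1),(-1,0,1),True), Minor ((0,-1,0),(0,0,-1),(0,0,1)) ((-1,-1,0),(0,-1,1),(-1,0,1))),
    (((0,0,1),(-1,0,-1),False), Minor ((0,0,-1),(0,0,1),(-1,0,0)) ((-1,0,1),(-1,0,-1),(-1,-1,0))),
    (((1,0,0),(-1,0,-1),False), Minor ((0,0,-1),(1,0,0),(-1,0,0)) ((-1,0,1),(-1,0,-1),(-1,-1,0))),
    (((0,-1,0),(-1,0,-1),False), Minor ((0,-1,0),(0,0,-1),(1,0,0)) ((-1,0,-1),(-1,0,1),(0,0,0))),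
    (((0,0,1),(0,-1,-1),False), Minor ((0,0,-1),(0,0,1),(0,-1,0)) ((0,-1,1),(0,-1,-1),(-1,-1,0))),
    (((1,0,0),(0,-1,-1),False), Previous 13 (XYZ,False,False,False)),
    (((0,0,1),(1,-1,0),False), Previous 13 (ZYX,True,False,False)),
    (((1,-1,1),(-1,0,-1),False), Minor ((0,0,1),(1,-1,1),(1,0,0)) ((0,-1,1),(-1,0,-1),(1,-1,0))),
    (((1,-1,1),(0,-1,-1),False), Minor ((0,0,1),(1,-1,1),(1,0,0)) ((0,-1,1),(0,-1,-1),(1,-1,0))),
    (((1,-1,1),(-1,-1,0),False), Minor ((0,0,1),(1,-1,1),(1,0,0)) ((0,-1,1),(-1,-1,0),(1,-1,0))),
    (((0,-1,0),(1,0,-1),True), Minor ((0,-1,0),(0,0,-1),(1,0,0)) ((0,-1,-1),(-1,0,1),(1,0,-1))),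
    (((-1,0,0),(0,-1,-1),False), Minor ((-1,0,0),(0,0,-1),(1,0,0)) ((0,-1,-1),(-1,0,1),(0,0,0))),
    (((1,-1,1),(-1,0,1),False), Minor ((-1,0,0),(0,-1,0),(1,-1,1)) ((-1,0,-1),(0,-1,-1),(-1,0,1))),
    (((1,-1,1),(0,0,0),False), Minor ((-1,0,0),(0,0,-1),(1,-1,1)) ((-1,-1,0),(0,-1,-1),(0,0,0))),
    (((1,-1,1),(1,0,-1),False), Minor ((0,0,-1),(1,-1,1),(1,0,0)) ((-1,0,1),(1,0,-1),(0,0,0))),
    (((1,-1,-1),(-1,0,1),False), Minor ((0,-1,0),(1,-1,-1),(1,-1,1)) ((1,0,-1),(-1,0,1),(1,-1,0))),
    (((1,-1,-1),(0,0,0),True), Minor ((0,0,-1),(1,-1,-1),(1,0,0)) ((-1,0,1),(0,-1,-1),(0,0,0))),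
    (((0,0,-1),(1,-1,0),False), Minor ((0,-1,0),(0,0,-1),(1,-1,-1)) ((1,0,-1),(1,-1,0),(0,0,0))),
    (((0,0,1),(1,0,-1),False), Minor ((0,0,-1),(0,0,1),(1,0,0)) ((-1,0,1),(1,0,-1),(1,-1,0)))],
   Previous 17 (ZYX,False,False,False)),
  ([((0,0,-1),(-1,0,1),False), ((1,0,0),(-1,0,1),True), ((0,0,-1),(0,-1,1),True), ((0,0,-1),(-1,-1,0),True), ((1,0,0),(-1,-1,0),True), ((1,0,0),(0,-1,1),True)],
   [(((-1,0,0),(0,-1,1),False), Minor ((-1,0,0),(0,0,-1),(1,0,0)) ((0,-1,1),(-1,0,1),(0,0,0))),
    (((0,0,1),(-1,-1,0),True), Minor ((-1,0,0),(0,0,-1),(0,0,1)) ((-1,-1,0),(-1,0,1),(0,-1,1)))],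
   Minor ((0,0,-1),(0,0,1),(1,0,0)) ((-1,0,1),(-1,-1,0),(0,0,0))),
  ([((1,0,0),(-1,0,-1),True), ((-1,0,0),(0,-1,1),False), ((0,0,1),(-1,-1,0),True), ((0,0,-1),(1,-1,0),True), ((1,0,0),(0,-1,-1),True), ((0,0,-1),(0,-1,1),True), ((1,0,0),(-1,-1,0),True), ((1,0,0),(0,-1,1),True)],
   [(((0,0,1),(0,-1,-1),False), Previous 18 (XYZ,False,False,True)),
    (((0,0,1),(-1,0,-1),False), Minor ((-1,0,0),(0,0,1),(1,0,0)) ((0,-1,1),(-1,0,-1),(0,0,0))),
    (((0,0,1),(1,-1,0),False), Previous 13 (ZYX,True,False,False))],
   Minor ((0,0,-1),(0,0,1),(1,0,0)) ((-1,0,-1),(0,-1,1),(1,-1,0))),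
  ([((-1,0,0),(0,-1,1),False), ((0,0,1),(-1,-1,0),True), ((0,0,-1),(1,-1,0),True), ((1,0,0),(0,-1,-1),True), ((0,0,-1),(0,-1,1),True), ((1,0,0),(-1,-1,0),True), ((1,0,0),(0,-1,1),True)],
   [(((1,0,0),(-1,0,-1),True), Previous 20 (XYZ,False,False,False)),
    (((-1,-1,-1),(0,-1,1),True), Minor ((-1,-1,-1),(-1,0,0),(1,0,0)) ((-1,-1,0),(0,-1,1),(-1,0,-1)))],
   Minor ((-1,-1,-1),(0,0,-1),(1,0,0)) ((0,-1,1),(0,-1,-1),(-1,0,-1))),
  ([((1,0,0),(-1,0,-1),False), ((0,0,1),(-1,-1,0),True), ((1,0,0),(-1,0,1),True), ((0,0,-1),(0,-1,1),True), ((0,0,-1),(-1,-1,0),True), ((1,0,0),(-1,-1,0),True), ((1,0,0),(0,-1,1),True)],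
   [(((0,0,-1),(-1,0,1),False), Previous 19 (XYZ,False,False,False)),
    (((0,0,-1),(1,-1,0),False), Previous 13 (ZYX,True,False,True)),
    (((1,0,0),(0,-1,-1),False), Previous 13 (XYZ,False,False,False)),
    (((-1,-1,-1),(-1,0,1),False), Minor ((-1,-1,-1),(0,0,-1),(1,0,0)) ((-1,0,1),(0,-1,-1),(-1,0,-1))),
    (((-1,0,0),(0,-1,-1),True), Minor ((-1,0,0),(0,0,-1),(1,0,0)) ((-1,-1,0),(0,-1,-1),(-1,0,-1))),
    (((-1,0,0),(0,-1,1),False), Previous 21 (XYZ,False,False,False)),
    (((-1,-1,-1),(0,-1,1),False), Minor ((-1,-1,-1),(-1,0,0),(1,0,0)) ((0,-1,1),(-1,-1,0),(-1,0,-1))),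
    (((-1,-1,-1),(0,0,0),False), Minor ((-1,-1,-1),(-1,0,0),(0,-1,0)) ((0,0,0),(0,-1,-1),(0,-1,1))),
    (((-1,-1,-1),(1,-1,0),True), Previous 10 (XYZ,False,False,False)),
    (((1,-1,1),(0,0,0),True), Minor ((-1,-1,-1),(0,0,-1),(1,-1,1)) ((1,-1,0),(0,0,0),(0,-1,1))),
    (((0,-1,0),(-1,0,1),False), Previous 17 (XYZ,False,False,False)),
    (((1,-1,1),(-1,0,1),False), Minor ((-1,-1,-1),(0,-1,0),(1,-1,1)) ((1,-1,0),(0,-1,1),(-1,0,1))),
    (((0,0,-1),(1,0,1),False), Minor ((0,0,-1),(1,-1,1),(0,0,1)) ((1,0,1),(0,0,0),(-1,0,1))),
    (((-1,0,0),(1,-1,0),False), Previous 18 (ZYX,False,False,True))],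
   Minor ((-1,-1,-1),(-1,0,0),(0,-1,0)) ((1,-1,0),(-1,0,1),(0,-1,1))),
  ([((0,0,1),(-1,-1,0),True), ((1,0,0),(-1,0,1),True), ((0,0,-1),(0,-1,1),True), ((0,0,-1),(-1,-1,0),True), ((1,0,0),(-1,-1,0),True), ((1,0,0),(0,-1,1),True)],
   [(((1,0,0),(-1,0,-1),False), Previous 22 (XYZ,False,False,False)),
    (((0,0,1),(0,-1,-1),False), Previous 18 (XYZ,False,False,True)),
    (((0,-1,0),(-1,0,-1),False), Previous 17 (XYZ,False,False,True)),
    (((0,0,-1),(-1,0,1),False), Previous 19 (XYZ,False,False,False)),
    (((0,0,-1),(1,-1,0),False), Previous 13 (ZYX,True,False,True)),
    (((1,0,0),(0,-1,-1),False), Previous 13 (XYZ,False,False,False)),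
    (((0,0,1),(-1,0,-1),False), Previous 19 (XYZ,False,False,True)),
    (((-1,0,0),(0,-1,1),False), Previous 21 (XYZ,False,False,False)),
    (((0,0,-1),(1,0,1),False), Previous 22 (ZYX,True,False,True)),
    (((0,-1,0),(1,0,1),False), Previous 17 (ZYX,False,False,True))],
   Minor ((0,-1,0),(0,0,-1),(0,0,1)) ((-1,-1,0),(-1,0,-1),(1,0,1))),
  ([((1,0,0),(-1,0,1),True), ((0,0,-1),(0,-1,1),True), ((0,0,-1),(-1,-1,0),True), ((1,0,0),(-1,-1,0),True), ((1,0,0),(0,-1,1),True)],
   [(((0,0,1),(-1,-1,0),True), Previous 23 (XYZ,False,False,False)),
    (((-1,0,0),(0,-1,1),False), Minor ((-1,0,0),(0,0,1),(1,0,0)) ((0,-1,1),(-1,-1,0),(0,0,0))),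
    (((0,0,-1),(-1,0,1),True), Previous 23 (ZYX,True,False,True))],
   Previous 19 (XYZ,False,False,False)),
  ([((0,0,-1),(-1,-1,0),True), ((0,0,1),(-1,-1,0),False), ((0,0,-1),(0,-1,1),True), ((1,0,0),(-1,-1,0),True), ((1,0,0),(0,-1,1),True)],
   [(((0,0,-1),(-1,0,1),True), Previous 24 (ZYX,True,False,True)),
    (((1,0,0),(-1,0,1),True), Previous 24 (XYZ,False,False,False)),
    (((-1,-1,1),(0,0,0),False), Minor ((-1,-1,1),(0,0,1),(1,0,0)) ((0,0,0),(-1,-1,0),(-1,0,1))),
    (((-1,-1,1),(1,0,1),False), Minor ((-1,-1,1),(0,0,1),(1,0,0)) ((1,0,1),(-1,-1,0),(-1,0,1))),
    (((-1,0,0),(0,-1,1),False), Minor ((-1,0,0),(0,0,1),(1,0,0)) ((0,-1,1),(-1,-1,0),(0,0,0))),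
    (((-1,0,0),(1,0,1),False), Minor ((-1,0,0),(1,0,0),(0,0,1)) ((1,0,1),(-1,0,1),(0,-1,1))),
    (((0,0,-1),(1,0,1),False), Minor ((-1,-1,1),(-1,0,0),(0,0,-1)) ((0,-1,1),(0,0,0),(1,0,1))),
    (((0,-1,0),(1,0,1),False), Minor ((-1,-1,1),(-1,0,0),(0,-1,0)) ((0,-1,1),(0,0,0),(1,0,1))),
    (((0,0,-1),(1,-1,0),False), Minor ((0,-1,0),(0,0,-1),(1,0,0)) ((-1,-1,0),(1,-1,0),(1,0,1))),
    (((-1,0,0),(1,-1,0),True), Previous 22 (ZYX,False,False,True))],
   Minor ((-1,0,0),(0,-1,0),(1,0,0)) ((1,-1,0),(0,-1,1),(1,0,1))),
  ([((1,0,0),(-1,0,1),False), ((0,0,1),(-1,-1,0),False), ((0,0,-1),(0,-1,1),True), ((1,0,0),(-1,-1,0),True), ((1,0,0),(0,-1,1),True)],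
   [(((-1,-1,1),(0,0,0),False), Minor ((-1,-1,1),(0,0,1),(1,0,0)) ((0,0,0),(-1,-1,0),(-1,0,1))),
    (((-1,-1,1),(1,0,1),False), Minor ((-1,-1,1),(0,0,1),(1,0,0)) ((1,0,1),(-1,-1,0),(-1,0,1))),
    (((0,0,-1),(-1,-1,0),True), Previous 25 (XYZ,False,False,False)),
    (((0,0,-1),(1,0,1),True), Minor ((-1,-1,1),(0,0,-1),(1,0,0)) ((0,-1,1),(-1,-1,0),(1,0,1))),
    (((-1,0,0),(0,-1,1),False), Minor ((-1,0,0),(0,0,1),(1,0,0)) ((0,-1,1),(-1,-1,0),(0,0,0))),
    (((-1,0,0),(1,0,1),True), Minor ((-1,-1,1),(-1,0,0),(0,0,-1)) ((0,-1,1),(0,0,0),(1,0,1)))],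
   Minor ((-1,0,0),(1,0,0),(0,0,1)) ((1,0,1),(-1,0,1),(0,-1,1))),
  ([((0,0,1),(-1,-1,0),False), ((0,0,-1),(0,-1,1),True), ((1,0,0),(-1,-1,0),True), ((1,0,0),(0,-1,1),True)],
   [(((1,0,0),(-1,0,1),False), Previous 26 (XYZ,False,False,False)),
    (((0,0,-1),(-1,-1,0),True), Previous 25 (XYZ,False,False,False)),
    (((0,0,-1),(-1,0,1),True), Previous 15 (ZYX,True,False,True)),
    (((1,0,0),(0,-1,-1),False), Minor ((0,0,-1),(1,0,0),(0,-1,0)) ((-1,-1,0),(0,-1,-1),(0,-1,1))),
    (((0,0,1),(0,-1,-1),False), Minor ((0,0,-1),(0,0,1),(1,0,0)) ((-1,0,1),(0,-1,-1),(0,0,0))),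
    (((1,0,0),(-1,0,-1),False), Previous 26 (XYZ,False,False,True)),
    (((0,0,1),(-1,0,-1),False), Minor ((0,0,-1),(0,0,1),(1,0,0)) ((-1,0,1),(-1,0,-1),(0,0,0)))],
   Previous 15 (ZYX,True,False,False)),
  ([((0,0,-1),(-1,-1,0),False), ((0,0,-1),(0,-1,1),True), ((1,0,0),(-1,-1,0),True), ((1,0,0),(0,-1,1),True)],
   [(((1,0,0),(0,-1,-1),False), Minor ((0,0,-1),(1,0,0),(0,-1,0)) ((-1,-1,0),(0,-1,-1),(0,-1,1))),
    (((0,0,1),(-1,-1,0),False), Previous 27 (XYZ,False,False,False)),
    (((0,0,1),(0,-1,-1),True), Previous 25 (XYZ,False,False,True))],
   Minor ((0,0,-1),(0,0,1),(1,0,0)) ((-1,-1,0),(0,-1,-1),(0,0,0))),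
  ([((0,0,-1),(0,-1,1),True), ((1,0,0),(-1,-1,0),True), ((1,0,0),(0,-1,1),True)],
   [(((0,0,-1),(-1,-1,0),False), Previous 28 (XYZ,False,False,False)),
    (((-1,0,0),(0,-1,1),False), Previous 25 (ZYX,True,False,True)),
    (((1,0,0),(-1,0,1),True), Previous 24 (XYZ,False,False,False)),
    (((0,0,1),(-1,-1,0),True), Minor ((-1,0,0),(0,0,1),(1,0,0)) ((-1,-1,0),(0,-1,1),(-1,0,1)))],
   Previous 27 (XYZ,False,False,False)),
  ([((0,0,1),(-1,-1,0),True), ((1,0,0),(-1,-1,0),True), ((1,0,0),(0,-1,1),True)],
   [(((0,0,1),(0,-1,-1),True), Previous 29 (ZYX,True,False,False)),
    (((1,0,0),(-1,0,-1),True), Previous 18 (XYZ,False,False,True)),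
    (((0,0,-1),(0,-1,1),True), Previous 29 (XYZ,False,False,False)),
    (((0,0,-1),(-1,-1,0),True), Minor ((0,0,-1),(0,0,1),(0,-1,0)) ((0,-1,1),(0,-1,-1),(-1,-1,0))),
    (((-1,0,0),(1,0,-1),False), Minor ((-1,0,0),(0,0,-1),(1,0,0)) ((1,0,-1),(-1,-1,0),(-1,0,-1))),
    (((1,0,0),(0,-1,-1),True), Minor ((0,0,-1),(0,0,1),(1,0,0)) ((0,-1,1),(0,-1,-1),(0,0,0))),
    (((0,-1,0),(1,0,-1),False), Minor ((0,-1,0),(0,0,-1),(1,0,0)) ((1,0,-1),(0,-1,1),(0,-1,-1))),
    (((0,-1,0),(0,1,-1),True), Previous 29 (ZXY,False,True,False)),
    (((-1,0,0),(1,1,0),True), Previous 18 (XZY,True,False,False)),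
    (((0,0,-1),(1,1,0),True), Minor ((-1,0,0),(0,0,-1),(1,0,0)) ((1,1,0),(-1,-1,0),(-1,0,-1))),
    (((1,0,0),(0,1,-1),True), Minor ((0,-1,0),(0,0,-1),(1,0,0)) ((0,1,-1),(0,-1,1),(1,0,-1))),
    (((0,1,0),(1,0,-1),False), Minor ((0,0,-1),(0,1,0),(1,0,0)) ((1,1,0),(1,0,-1),(0,1,-1))),
    (((0,1,0),(0,-1,-1),False), Minor ((0,-1,0),(0,1,0),(0,0,-1)) ((0,1,-1),(0,-1,-1),(1,0,-1)))],
   Previous 27 (ZXY,False,False,False)),
  ([((1,0,0),(-1,0,1),False), ((1,0,0),(-1,-1,0),True), ((1,0,0),(0,-1,1),True)],
   [(((0,0,1),(-1,-1,0),True), Previous 30 (XYZ,False,False,False)),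
    (((-1,-1,1),(0,0,0),False), Minor ((-1,-1,1),(0,0,1),(1,0,0)) ((0,0,0),(-1,-1,0),(-1,0,1))),
    (((-1,-1,1),(1,0,1),False), Minor ((-1,-1,1),(0,0,1),(1,0,0)) ((1,0,1),(-1,-1,0),(-1,0,1))),
    (((-1,0,0),(0,-1,1),False), Minor ((-1,0,0),(0,0,1),(1,0,0)) ((0,-1,1),(-1,-1,0),(0,0,0))),
    (((-1,0,0),(1,0,1),False), Minor ((-1,0,0),(1,0,0),(0,0,1)) ((1,0,1),(-1,0,1),(0,-1,1))),
    (((0,-1,0),(1,0,1),False), Minor ((-1,-1,1),(-1,0,0),(0,-1,0)) ((0,-1,1),(0,0,0),(1,0,1)))],
   Previous 30 (XZY,True,True,True)),
  ([((1,0,0),(-1,-1,0),True), ((1,0,0),(0,-1,1),True)],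
   [(((1,0,0),(-1,0,1),False), Previous 31 (XYZ,False,False,False)),
    (((0,-1,0),(-1,0,1),True), Previous 30 (XZY,False,True,True)),
    (((0,0,1),(-1,-1,0),False), Minor ((0,-1,0),(0,0,1),(1,0,0)) ((-1,0,1),(-1,-1,0),(0,0,0)))],
   Previous 30 (XYZ,False,False,False)),
  ([((-1,0,0),(0,-1,1),True), ((1,0,0),(0,-1,1),True)],
   [(((-1,0,0),(1,-1,0),True), Previous 32 (XYZ,True,False,False)),
    (((1,0,0),(-1,-1,0),False), Minor ((-1,0,0),(1,0,0),(0,-1,0)) ((1,-1,0),(-1,-1,0),(0,-1,1)))],
   Previous 32 (XYZ,False,False,False)),
  ([((0,0,1),(-1,-1,0),False), ((-1,0,0),(0,-1,1),False)],
   [(((0,-1,0),(-1,0,1),False), Minor ((-1,0,0),(0,-1,0),(0,0,1)) ((0,-1,1),(-1,0,1),(-1,-1,0))),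
    (((0,1,0),(-1,0,1),True), Previous 33 (YXZ,False,False,False)),
    (((0,-1,0),(0,1,1),True), Previous 32 (ZXY,True,True,True)),
    (((-1,0,0),(0,1,1),True), Minor ((-1,0,0),(0,-1,0),(0,0,1)) ((0,-1,1),(0,1,1),(-1,-1,0))),
    (((0,0,1),(-1,1,0),False), Minor ((-1,0,0),(0,0,1),(0,1,0)) ((0,1,1),(-1,1,0),(-1,0,1))),
    (((0,-1,0),(-1,1,0),False), Minor ((-1,0,0),(0,-1,0),(0,0,1)) ((0,-1,1),(-1,1,0),(-1,-1,0)))],
   Previous 32 (YXZ,False,True,False)),
  ([((-1,0,0),(0,-1,1),False)],
   [(((0,-1,0),(-1,0,1),False), Previous 34 (XZY,False,True,True)),
    (((0,1,0),(-1,0,1),True), Previous 33 (YXZ,False,False,False)),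
    (((0,0,1),(-1,1,0),False), Previous 34 (YXZ,False,True,False)),
    (((0,-1,0),(-1,1,0),True), Previous 32 (YXZ,False,True,False)),
    (((0,0,1),(-1,-1,0),False), Previous 34 (XYZ,False,False,False)),
    (((0,0,-1),(-1,-1,0),True), Previous 33 (YZX,False,True,False)),
    (((-1,0,0),(0,-1,-1),False), Previous 34 (XYZ,False,False,True)),
    (((0,0,1),(0,-1,-1),False), Minor ((-1,0,0),(0,-1,0),(0,0,1)) ((0,-1,1),(-1,1,0),(0,-1,-1)))],
   Previous 32 (ZYX,True,False,False)),
  ([],
   [(((1,0,0),(0,-1,1),False), Previous 35 (XYZ,True,False,False)),
    (((-1,0,0),(0,-1,1),True), Previous 33 (XYZ,False,False,False))],
   Previous 35 (XYZ,False,False,False))]"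

text \<open>The unit clause before the empty one says that the face centre \<open>(-1,0,0)\<close>
  and the edge midpoint \<open>(0,-1,1)\<close> are too near. Its mirror image says so for
  \<open>(1,0,0)\<close> and the same midpoint, whereas an earlier clause with two literals makes
  one of these two pairs too far.\<close>

lemma certifies_cube_certificate: "certifies [] cube_certificate"
  unfolding cube_certificate_def by code_simp

section \<open>From a representation with one interval to a cube model\<close>

lemma grid3_3_3_3_not_PCG: "\<not> interval_PCG 1 (grid3 3 3 3)"
proof
  assume "interval_PCG 1 (grid3 3 3 3)"
  obtain T :: "nat pair_pre_digraph" and w \<zeta> and a b :: "nat \<Rightarrow> real"
    where PCG: "weighted_tree T w \<and> bij_betw \<zeta> (pverts (grid3 3 3 3)) (leaves T) \<and>
      (\<forall>j<1. a j \<le> b j) \<and> disjoint_family_on (\<lambda>j. {a j..b j}) {..<1} \<and>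
      (\<forall>u\<in>pverts (grid3 3 3 3). \<forall>v\<in>pverts (grid3 3 3 3). u \<noteq> v \<longrightarrow>
        ((u, v) \<in> parcs (grid3 3 3 3) \<longleftrightarrow> tree_dist T w (\<zeta> u) (\<zeta> v) \<in> (\<Union>j<1. {a j..b j})))"
    using \<open>interval_PCG 1 (grid3 3 3 3)\<close>[unfolded interval_PCG_def, THEN conjunct2]
    by (elim exE) (rule that)
  have W: "weighted_tree T w" and \<zeta>: "bij_betw \<zeta> (pverts (grid3 3 3 3)) (leaves T)"
    and ab: "a 0 \<le> b 0" using PCG by simp_all
  have "(\<Union>j<1. {a j..b j}) = {a 0..b 0}" by auto
  note PCG' = PCG[unfolded this]
  have adj: "(u, v) \<in> parcs (grid3 3 3 3) \<longleftrightarrow> tree_dist T w (\<zeta> u) (\<zeta> v) \<in> {a 0..b 0}"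
    if "u \<in> pverts (grid3 3 3 3)" "v \<in> pverts (grid3 3 3 3)" "u \<noteq> v" for u v
    using PCG' that by simp
  \<comment> \<open>Translation from the cube centred at the origin to the coordinates 0, 1, 2 of
    the grid.\<close>
  define sh :: "point \<Rightarrow> point" where "sh = (\<lambda>(x, y, z). (x + 1, y + 1, z + 1))"
  have sh_vert: "sh u \<in> pverts (grid3 3 3 3)" if "u \<in> cube" for u
    using that by (cases u) (auto simp: sh_def cube_def grid3_def grid3_verts_def)
  have sh_eq: "sh u = sh v \<longleftrightarrow> u = v" for u v by (cases u; cases v) (auto simp: sh_def)
  have sh_adj: "grid3_adj (sh u) (sh v) \<longleftrightarrow> grid3_adj u v" for u v
    by (cases u; cases v) (simp add: sh_def)
  have tree_vert: "\<zeta> (sh u) \<in> pverts T" if "u \<in> cube" for u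
    using bij_betwE[OF \<zeta>] sh_vert[OF that] by (auto simp: leaves_def)
  define D where "D u v = tree_dist T w (\<zeta> (sh u)) (\<zeta> (sh v))" for u v
  have "minors_singular cube D"
    unfolding D_def
  proof (rule four_point_imp_minors_singular)
    fix x y z t assume "x \<in> cube" "y \<in> cube" "z \<in> cube" "t \<in> cube"
    then show "tree_dist T w (\<zeta> (sh x)) (\<zeta> (sh y)) + tree_dist T w (\<zeta> (sh z)) (\<zeta> (sh t))
          \<le> tree_dist T w (\<zeta> (sh x)) (\<zeta> (sh z)) + tree_dist T w (\<zeta> (sh y)) (\<zeta> (sh t)) \<or>
        tree_dist T w (\<zeta> (sh x)) (\<zeta> (sh y)) + tree_dist T w (\<zeta> (sh z)) (\<zeta> (sh t))
          \<le> tree_dist T w (\<zeta> (sh x)) (\<zeta> (sh t)) + tree_dist T w (\<zeta> (sh y)) (\<zeta> (sh z))"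
      by (intro tree_dist_four_point[OF W] tree_vert)
  qed (intro tree_dist_commute[OF W] tree_vert)
  moreover have "if grid3_adj u v then a 0 \<le> D u v \<and> D u v \<le> b 0 else D u v < a 0 \<or> b 0 < D u v"
    if uv: "u \<in> cube" "v \<in> cube" "u \<noteq> v" for u v
  proof -
    have "grid3_adj u v \<longleftrightarrow> (sh u, sh v) \<in> parcs (grid3 3 3 3)"
      using sh_vert[OF uv(1)] sh_vert[OF uv(2)] sh_adj by (simp add: grid3_def)
    also have "\<dots> \<longleftrightarrow> D u v \<in> {a 0..b 0}"
      using adj[OF sh_vert[OF uv(1)] sh_vert[OF uv(2)]] uv(3) by (simp add: D_def sh_eq)
    finally show ?thesis by auto
  qed
  ultimately have "cube_model (a 0) (b 0) D" using ab unfolding cube_model_def by blast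
  then show False using certifies_sound[OF certifies_cube_certificate] by simp
qed

section \<open>Combs\<close>

lemma closed_walk_nth:
  assumes "pre_digraph.cas (with_proj T) u p v" "i < length p"
  shows "snd (p ! i) = (if Suc i < length p then fst (p ! Suc i) else v)"
  using assms
proof (induction p arbitrary: u i)
  case (Cons e p)
  then show ?case by (cases i; cases p) (auto simp: pre_digraph.cas.simps)
qed simp

lemma awalk_verts_eq_map_snd:
  assumes "pre_digraph.cas (with_proj T) u p v"
  shows "pre_digraph.awalk_verts (with_proj T) u p = u # map snd p"
  using assms
  by (induction p arbitrary: u) (simp_all add: pre_digraph.cas.simps pre_digraph.awalk_verts.simps)

text \<open>On a cycle, both neighbours of the largest vertex must be its parent, hence are equal.
  As the vertices of a cycle are distinct, going two steps around it is the identity, so its length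
  divides 2.\<close>

lemma no_cycle_if_parent:
  fixes T :: "nat pair_pre_digraph"
  assumes parent: "\<And>u v. (u, v) \<in> parcs T \<Longrightarrow> u = parent v \<and> u < v \<or> v = parent u \<and> v < u"
    and cycle: "pre_digraph.cycle (with_proj T) p"
  shows "length p < 3"
proof -
  obtain u where wu: "pre_digraph.awalk (with_proj T) u p u"
    and d: "distinct (tl (pre_digraph.awalk_verts (with_proj T) u p))" and ne: "p \<noteq> []"
    using cycle by (auto simp: pre_digraph.cycle_def)
  have cas: "pre_digraph.cas (with_proj T) u p u" and arcs: "set p \<subseteq> parcs T"
    using wu by (auto simp: pre_digraph.awalk_def)
  have hd: "fst (p ! 0) = u" using cas ne by (cases p) (auto simp: pre_digraph.cas.simps)
  define n where "n = length p"
  have n: "0 < n" using ne by (simp add: n_def)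
  have next_arc: "snd (p ! i) = fst (p ! (Suc i mod n))" if "i < n" for i
    using closed_walk_nth[OF cas, of i] that hd unfolding n_def by (cases "Suc i = length p") auto
  have "tl (pre_digraph.awalk_verts (with_proj T) u p) = map snd p"
    using awalk_verts_eq_map_snd[OF cas] by simp
  then have ds: "distinct (map snd p)" using d by simp
  \<comment> \<open>Arc \<open>i\<close> enters the largest vertex, arc \<open>j\<close> below
    leaves it, and arc \<open>h\<close> precedes arc \<open>i\<close>, with indices taken
    cyclically.\<close>
  obtain i where i: "i < n" "\<And>j. j < n \<Longrightarrow> snd (p ! j) \<le> snd (p ! i)"
  proof -
    have "Max (snd ` set p) \<in> snd ` set p" using ne by (intro Max_in) auto
    then obtain i where "i < length p" "snd (p ! i) = Max (snd ` set p)"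
      by (metis imageE in_set_conv_nth)
    then show ?thesis using that[of i] by (simp add: n_def)
  qed
  define j where "j = Suc i mod n"
  have j: "j < n" using n by (simp add: j_def)
  have ij: "snd (p ! i) = fst (p ! j)" using next_arc i(1) by (simp add: j_def)
  have ai: "(fst (p ! i), snd (p ! i)) \<in> parcs T" and aj: "(fst (p ! j), snd (p ! j)) \<in> parcs T"
    using arcs i(1) j nth_mem unfolding n_def by (metis prod.collapse subsetD)+
  obtain h where h: "h < n" "i = Suc h mod n"
  proof (cases i)
    case 0
    then show ?thesis using that[of "n - 1"] n by simp
  next
    case (Suc m)
    then show ?thesis using that[of m] i(1) by simp
  qed
  have hi: "snd (p ! h) = fst (p ! i)" using next_arc[OF h(1)] h(2) by simp
  have "fst (p ! i) = parent (snd (p ! i))"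
    using parent[OF ai] i(2)[OF h(1)] hi by auto
  moreover have "snd (p ! j) = parent (fst (p ! j))"
    using parent[OF aj] i(2)[OF j] ij by auto
  ultimately have "snd (p ! j) = snd (p ! h)" using hi ij by simp
  then have "j = h" using ds j h(1) unfolding n_def by (simp add: distinct_conv_nth) metis
  then have "Suc (Suc h mod n) mod n = h" using h by (simp add: j_def)
  then have "Suc (Suc h) mod n = h mod n" using h(1) by (simp add: mod_Suc_eq)
  then have "n dvd 2" using mod_eq_dvd_iff_nat[of h "Suc (Suc h)" n] by simp
  then show ?thesis using dvd_imp_le[of n 2] n_def by simp
qed

section \<open>The comb tree and its leaf distances\<close>

text \<open>The spine vertex at position \<open>i\<close> is \<open>2 * i\<close>; the leaf attached to it, if any, is \<open>2 * i + 1\<close>.\<close>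

definition comb_arcs :: "nat \<Rightarrow> nat set \<Rightarrow> (nat \<times> nat) set" where
  "comb_arcs m S = {(2 * i, 2 * i + 2) |i. i < m} \<union> {(2 * i, 2 * i + 1) |i. i \<in> S}"

definition comb :: "nat \<Rightarrow> nat set \<Rightarrow> nat pair_pre_digraph" where
  "comb m S = \<lparr>pverts = {2 * i |i. i \<le> m} \<union> {2 * i + 1 |i. i \<in> S},
     parcs = comb_arcs m S \<union> (comb_arcs m S)\<inverse>\<rparr>"

context
  fixes m :: nat and S :: "nat set"
  assumes S: "S \<subseteq> {..m}"
begin

lemma comb_verts: "2 * i \<in> pverts (comb m S) \<longleftrightarrow> i \<le> m" "2 * i + 1 \<in> pverts (comb m S) \<longleftrightarrow> i \<in> S"
  by (auto simp: comb_def) presburger+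

lemma comb_pair_graph: "pair_graph (comb m S)"
proof
  have fS: "finite S" using S finite_subset by blast
  then show "finite (pverts (comb m S))"
    by (simp add: comb_def setcompr_eq_image Collect_conj_eq)
  have "finite (comb_arcs m S)" using fS by (simp add: comb_arcs_def setcompr_eq_image)
  then show "finite (parcs (comb m S))" by (simp add: comb_def)
  show "symmetric (with_proj (comb m S))"
    by (auto simp: comb_def symmetric_def sym_def arcs_ends_def arc_to_ends_def)
next
  have verts: "u \<in> pverts (comb m S) \<and> v \<in> pverts (comb m S) \<and> u \<noteq> v" if uv: "(u, v) \<in> comb_arcs m S" for u v
  proof -
    consider i where "u = 2 * i" "v = 2 * (i + 1)" "i < m" | i where "u = 2 * i" "v = 2 * i + 1" "i \<in> S"
      using uv by (auto simp: comb_arcs_def)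
    then show ?thesis by cases (use S in \<open>simp_all only: comb_verts; auto\<close>)+
  qed
  fix e assume "e \<in> parcs (comb m S)"
  then have "e \<in> comb_arcs m S \<or> (snd e, fst e) \<in> comb_arcs m S"
    by (cases e) (simp add: comb_def)
  then show "fst e \<in> pverts (comb m S)" "snd e \<in> pverts (comb m S)" "fst e \<noteq> snd e"
    using verts[of "fst e" "snd e"] verts[of "snd e" "fst e"] by auto
qed

text \<open>The vertex list belongs to the claim because the induction step has to know that
  \<open>2 * i\<close> does not occur on the rest of the path.\<close>

lemma comb_spine_walk:
  assumes "i \<le> j" "j \<le> m"
  shows "pre_digraph.apath (with_proj (comb m S)) (2 * i) (map (\<lambda>k. (2 * k, 2 * k + 2)) [i..<j]) (2 * j) \<and>
    pre_digraph.awalk_verts (with_proj (comb m S)) (2 * i) (map (\<lambda>k. (2 * k, 2 * k + 2)) [i..<j]) =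
      map (\<lambda>k. 2 * k) [i..<Suc j]"
proof -
  interpret pair_graph "comb m S" by (rule comb_pair_graph)
  show ?thesis using assms
  proof (induction "j - i" arbitrary: i)
    case 0
    then show ?case using comb_verts(1)[of i] by (simp add: apath_Nil_iff)
  next
    case (Suc d)
    then have ij: "i < j" by simp
    then have up: "[i..<j] = i # [Suc i..<j]" "[i..<Suc j] = i # [Suc i..<Suc j]"
      by (simp_all add: upt_conv_Cons)
    have IH: "apath (2 * Suc i) (map (\<lambda>k. (2 * k, 2 * k + 2)) [Suc i..<j]) (2 * j)"
      "awalk_verts (2 * Suc i) (map (\<lambda>k. (2 * k, 2 * k + 2)) [Suc i..<j]) = map (\<lambda>k. 2 * k) [Suc i..<Suc j]"
      using Suc.hyps(1)[of "Suc i"] Suc.hyps(2) Suc.prems ij by simp_all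
    have "(2 * i, 2 * i + 2) \<in> parcs (comb m S)"
      using ij Suc.prems by (auto simp: comb_def comb_arcs_def)
    then show ?case using IH unfolding up by (auto simp: apath_Cons_iff)
  qed
qed

lemma comb_undirected_tree: "undirected_tree (comb m S)"
proof -
  interpret pair_graph "comb m S" by (rule comb_pair_graph)
  have root: "0 \<rightarrow>\<^sup>*\<^bsub>with_proj (comb m S)\<^esub> v" if v: "v \<in> pverts (comb m S)" for v
  proof -
    have spine: "0 \<rightarrow>\<^sup>*\<^bsub>with_proj (comb m S)\<^esub> (2 * i)" if "i \<le> m" for i
      using comb_spine_walk[of 0 i] that by (auto simp: reachable_apath)
    show ?thesis
    proof (cases "even v")
      case True
      then show ?thesis using v spine[of "v div 2"] by (auto simp: comb_def)
    next
      case False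
      then obtain i where i: "v = 2 * i + 1" "i \<in> S" using v by (auto simp: comb_def)
      then have "(2 * i, v) \<in> parcs (comb m S)" by (auto simp: comb_def comb_arcs_def)
      then have "(2 * i) \<rightarrow>\<^sup>*\<^bsub>with_proj (comb m S)\<^esub> v" by (rule reachable_adjI)
      moreover have "0 \<rightarrow>\<^sup>*\<^bsub>with_proj (comb m S)\<^esub> (2 * i)" using spine i(2) S by blast
      ultimately show ?thesis by (rule reachable_trans[rotated])
    qed
  qed
  have conn: "Digraph_Component.connected (with_proj (comb m S))"
  proof (rule wf_digraph.connectedI)
    show "wf_digraph (with_proj (comb m S))" by unfold_locales
  next
    show "verts (with_proj (comb m S)) \<noteq> {}" by (auto simp: comb_def)
  next
    fix u v assume "u \<in> verts (with_proj (comb m S))" "v \<in> verts (with_proj (comb m S))"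
    then have u: "0 \<rightarrow>\<^sup>*\<^bsub>with_proj (comb m S)\<^esub> u" and v: "0 \<rightarrow>\<^sup>*\<^bsub>with_proj (comb m S)\<^esub> v"
      using root by simp_all
    have "u \<rightarrow>\<^sup>*\<^bsub>with_proj (comb m S)\<^esub> 0" by (rule symmetric_reachable[OF sym_arcs u])
    then have "u \<rightarrow>\<^sup>*\<^bsub>with_proj (comb m S)\<^esub> v" using v by (rule reachable_trans)
    then show "u \<rightarrow>\<^sup>*\<^bsub>mk_symmetric (with_proj (comb m S))\<^esub> v"
      by (simp only: wf_digraph.reachable_mk_symmetric_eq[OF wf_digraph_axioms sym_arcs])
  qed
  \<comment> \<open>The numbering increases away from the root: the parent of a spine vertex is
    smaller by 2, that of a hanging leaf by 1.\<close>
  have acyclic: "\<not> (pre_digraph.cycle (with_proj (comb m S)) p \<and> 3 \<le> length p)" for p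
    using no_cycle_if_parent[of "comb m S" "\<lambda>v. if even v then v - 2 else v - 1" p]
    by (fastforce simp: comb_def comb_arcs_def)
  have "pverts (comb m S) \<noteq> {}" by (auto simp: comb_def)
  then show ?thesis
    using conn acyclic comb_pair_graph unfolding undirected_tree_def simple_graph_def by blast
qed

lemma comb_weighted_tree: "weighted_tree (comb m S) (\<lambda>_. 1)"
  by (simp add: weighted_tree_def comb_undirected_tree)

text \<open>The summand 2 comes from the two hanging edges; for \<open>i = j\<close> the distance
  would be 0 instead.\<close>

lemma comb_tree_dist:
  assumes "i \<in> S" "j \<in> S" "i \<noteq> j"
  shows "tree_dist (comb m S) (\<lambda>_. 1) (2 * i + 1) (2 * j + 1) = \<bar>real i - real j\<bar> + 2"
proof -
  interpret pair_graph "comb m S" by (rule comb_pair_graph)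
  have lt: "tree_dist (comb m S) (\<lambda>_. 1) (2 * i + 1) (2 * j + 1) = real j - real i + 2"
    if ij: "i \<in> S" "j \<in> S" "i < j" for i j
  proof -
    let ?q = "map (\<lambda>k. (2 * k, 2 * k + 2)) [i..<j]"
    have q: "apath (2 * i) ?q (2 * j)" "awalk_verts (2 * i) ?q = map (\<lambda>k. 2 * k) [i..<Suc j]"
      using comb_spine_walk[of i j] ij S by auto
    have l: "awlast (2 * i) ?q = 2 * j" using q(2) ij by simp
    have arcs: "(2 * i + 1, 2 * i) \<in> parcs (comb m S)" "(2 * j, 2 * j + 1) \<in> parcs (comb m S)"
      using ij by (auto simp: comb_def comb_arcs_def)
    have "apath (2 * j) [(2 * j, 2 * j + 1)] (2 * j + 1)"
      using arcs in_arcsD2 by (auto simp: apath_Cons_iff apath_Nil_iff)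
    then have "apath (2 * i) (?q @ [(2 * j, 2 * j + 1)]) (2 * j + 1)"
      using q l unfolding apath_append_iff by auto
    moreover have "2 * i + 1 \<notin> set (awalk_verts (2 * i) (?q @ [(2 * j, 2 * j + 1)]))"
    proof -
      have "set (awalk_verts (2 * i) (?q @ [(2 * j, 2 * j + 1)])) =
          set (awalk_verts (2 * i) ?q) \<union> set (awalk_verts (2 * j) [(2 * j, 2 * j + 1)])"
        using q(1) arcs in_arcsD2 in_arcsD1 by (intro set_awalk_verts_append[of _ _ _ _ "2 * j + 1"])
          (auto simp: apath_def awalk_Cons_iff awalk_Nil_iff)
      then show ?thesis using q(2) ij(3) by auto presburger+
    qed
    ultimately have "apath (2 * i + 1) ((2 * i + 1, 2 * i) # ?q @ [(2 * j, 2 * j + 1)]) (2 * j + 1)"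
      using arcs by (simp add: apath_Cons_iff)
    then show ?thesis unfolding tree_dist_def
      by (subst tree_path_eqI[OF comb_undirected_tree]) (use ij in \<open>auto simp: sum_list_triv\<close>)
  qed
  have v: "2 * i + 1 \<in> pverts (comb m S)" "2 * j + 1 \<in> pverts (comb m S)"
    using assms by (auto simp: comb_def)
  show ?thesis
    using lt[OF assms(1,2)] lt[OF assms(2,1)] assms(3) tree_dist_commute[OF comb_weighted_tree v]
    by (cases "i < j") auto
qed

text \<open>Hanging leaves at both ends give every spine vertex degree at least 2. With
  \<open>m = 0\<close> the comb would be a single edge, whose spine vertex is a leaf as
  well.\<close>

lemma comb_leaves:
  assumes "0 \<in> S" "m \<in> S" "0 < m"
  shows "leaves (comb m S) = (\<lambda>i. 2 * i + 1) ` S"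
proof -
  interpret pair_graph "comb m S" by (rule comb_pair_graph)
  let ?T = "with_proj (comb m S)"
  have nsing: "pverts (comb m S) \<noteq> {v}" for v
  proof -
    have "0 \<in> pverts (comb m S)" "2 \<in> pverts (comb m S)" using assms(3) by (auto simp: comb_def intro: exI[of _ 1])
    then show ?thesis by auto
  qed
  have leaf: "out_degree ?T (2 * i + 1) = 1" if "i \<in> S" for i
  proof -
    have "out_arcs ?T (2 * i + 1) = {(2 * i + 1, 2 * i)}"
      using that by (auto simp: out_arcs_def comb_def comb_arcs_def) presburger+
    then show ?thesis by (simp add: out_degree_def)
  qed
  have spine: "out_degree ?T (2 * i) \<noteq> 1" if "i \<le> m" for i
  proof -
    obtain u v where uv: "u \<noteq> v" "(2 * i, u) \<in> parcs (comb m S)" "(2 * i, v) \<in> parcs (comb m S)"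
    proof (cases "i = 0")
      case True
      then show ?thesis using that[of 1 2] assms by (auto simp: comb_def comb_arcs_def)
    next
      case i0: False
      have d: "(2 * i, 2 * (i - 1)) \<in> parcs (comb m S)"
        using i0 \<open>i \<le> m\<close> by (auto simp: comb_def comb_arcs_def intro!: exI[of _ "i - 1"])
      show ?thesis
      proof (cases "i = m")
        case True
        then show ?thesis using that[of "2 * (i - 1)" "2 * i + 1"] d assms(2) i0
          by (auto simp: comb_def comb_arcs_def)
      next
        case False
        then show ?thesis using that[of "2 * (i - 1)" "2 * i + 2"] d i0 \<open>i \<le> m\<close>
          by (auto simp: comb_def comb_arcs_def)
      qed
    qed
    have "out_arcs ?T (2 * i) \<noteq> {e}" for e
    proof
      assume e: "out_arcs ?T (2 * i) = {e}"
      have "(2 * i, u) \<in> out_arcs ?T (2 * i)" "(2 * i, v) \<in> out_arcs ?T (2 * i)"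
        using uv(2,3) by (simp_all add: out_arcs_def)
      then show False using uv(1) unfolding e by auto
    qed
    then show ?thesis by (auto simp: out_degree_def card_1_singleton_iff)
  qed
  show ?thesis
  proof (intro set_eqI iffI)
    fix v assume "v \<in> leaves (comb m S)"
    then have v: "v \<in> pverts (comb m S)" "out_degree ?T v = 1" using nsing by (auto simp: leaves_def)
    then show "v \<in> (\<lambda>i. 2 * i + 1) ` S" using spine by (auto simp: comb_def)
  next
    fix v assume "v \<in> (\<lambda>i. 2 * i + 1) ` S"
    then show "v \<in> leaves (comb m S)" using leaf by (auto simp: leaves_def comb_def)
  qed
qed

end

section \<open>Two intervals suffice\<close>

definition position :: "nat \<Rightarrow> int \<times> int \<times> int \<Rightarrow> int" where
  "position n = (\<lambda>(x, y, z). int n * x + 2 * (int n)\<^sup>2 * y + (2 * (int n)\<^sup>2 + 1) * z)"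

lemma mult_eq_small:
  fixes n x r :: int
  assumes "n * x = r" "\<bar>r\<bar> < n"
  shows "x = 0 \<and> r = 0"
proof -
  have "x = 0"
  proof (rule ccontr)
    assume "x \<noteq> 0"
    then have "n * 1 \<le> \<bar>n\<bar> * \<bar>x\<bar>" using assms(2) by (intro mult_mono) auto
    then show False using assms by (simp add: abs_mult)
  qed
  then show ?thesis using assms by simp
qed

text \<open>Modulo \<open>2 * n\<^sup>2\<close> the position difference is \<open>n * x + z\<close>, which is smaller than \<open>n\<^sup>2\<close>
  in absolute value, so the two summands of the difference can be read off.\<close>

lemma position_difference:
  fixes n x y z :: int
  assumes "\<bar>x\<bar> + 1 < n" "\<bar>y\<bar> + 1 < n" "\<bar>z\<bar> + 1 < n"
  defines "p \<equiv> n * x + 2 * n\<^sup>2 * y + (2 * n\<^sup>2 + 1) * z"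
  shows "p = 0 \<longleftrightarrow> x = 0 \<and> y = 0 \<and> z = 0"
    and "p = n \<longleftrightarrow> x = 1 \<and> y = 0 \<and> z = 0"
    and "p = 2 * n\<^sup>2 \<longleftrightarrow> x = 0 \<and> y = 1 \<and> z = 0"
    and "p = 2 * n\<^sup>2 + 1 \<longleftrightarrow> x = 0 \<and> y = 0 \<and> z = 1"
proof -
  have n: "1 < n" using assms by linarith
  have p: "p = 2 * n\<^sup>2 * (y + z) + (n * x + z)" by (simp add: p_def algebra_simps)
  have "\<bar>n * x + z\<bar> \<le> n * \<bar>x\<bar> + \<bar>z\<bar>" using n by (simp add: abs_mult abs_triangle_ineq[THEN order_trans])
  also have "\<dots> \<le> n * (n - 2) + (n - 2)" using assms n by (intro add_mono mult_left_mono) auto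
  also have "\<dots> = n\<^sup>2 - n - 2" by (simp add: power2_eq_square algebra_simps)
  finally have r: "\<bar>n * x + z\<bar> \<le> n\<^sup>2 - n - 2" .
  \<comment> \<open>Uniqueness of the quotient by \<open>2 * n\<^sup>2\<close>: the remainder
    \<open>n * x + z\<close> is so small in absolute value that no target \<open>c\<close> between 0
    and \<open>n\<close> can cause a carry.\<close>
  have key: "y + z = s \<and> n * x + z = c" if "p = 2 * n\<^sup>2 * s + c" "0 \<le> c" "c \<le> n" for s c
  proof -
    have "2 * n\<^sup>2 * (y + z - s) = c - (n * x + z)" using that(1) p by (simp add: algebra_simps)
    moreover have "\<bar>c - (n * x + z)\<bar> < 2 * n\<^sup>2" using r that(2,3) n zero_less_power[of n 2] by linarith
    ultimately show ?thesis using mult_eq_small[of "2 * n\<^sup>2" "y + z - s" "c - (n * x + z)"] by simp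
  qed
  \<comment> \<open>The remainder is decomposed once more, now with base \<open>n\<close>; in
    \<open>key3\<close> the target is \<open>n\<close> itself, which gives
    \<open>x = 1\<close>.\<close>
  have key2: "x = 0 \<and> z = c" if "n * x + z = c" "0 \<le> c" "c \<le> 1" for c
    using mult_eq_small[of n x "c - z"] that assms(3) by (simp add: algebra_simps)
  have key3: "x = 1 \<and> z = 0" if "n * x + z = n"
    using mult_eq_small[of n "x - 1" "- z"] that assms(3) by (simp add: algebra_simps)
  show "p = 0 \<longleftrightarrow> x = 0 \<and> y = 0 \<and> z = 0"
    using key[of 0 0] key2[of 0] n by (auto simp: p_def)
  show "p = n \<longleftrightarrow> x = 1 \<and> y = 0 \<and> z = 0"
    using key[of 0 n] key3 n by (auto simp: p_def)
  show "p = 2 * n\<^sup>2 \<longleftrightarrow> x = 0 \<and> y = 1 \<and> z = 0"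
    using key[of 1 0] key2[of 0] n by (auto simp: p_def)
  show "p = 2 * n\<^sup>2 + 1 \<longleftrightarrow> x = 0 \<and> y = 0 \<and> z = 1"
    using key[of 1 1] key2[of 1] n by (auto simp: p_def)
qed

lemma grid3_simple_graph:
  assumes "1 \<le> n1" "1 \<le> n2" "1 \<le> n3"
  shows "simple_graph (grid3 n1 n2 n3)"
proof -
  have fin: "finite (grid3_verts n1 n2 n3)" by (simp add: grid3_verts_def)
  have sym: "grid3_adj u v \<Longrightarrow> grid3_adj v u" for u v by (cases u; cases v) auto
  have irrefl: "\<not> grid3_adj u u" for u by (cases u) auto
  have "pair_graph (grid3 n1 n2 n3)"
  proof
    have "parcs (grid3 n1 n2 n3) \<subseteq> grid3_verts n1 n2 n3 \<times> grid3_verts n1 n2 n3"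
      by (auto simp: grid3_def)
    then show "finite (parcs (grid3 n1 n2 n3))" using fin finite_subset by blast
    show "symmetric (with_proj (grid3 n1 n2 n3))"
      using sym by (auto simp: grid3_def symmetric_def sym_def arcs_ends_def arc_to_ends_def)
  qed (use fin irrefl in \<open>auto simp: grid3_def\<close>)
  moreover have "(0, 0, 0) \<in> pverts (grid3 n1 n2 n3)"
    using assms by (simp add: grid3_def grid3_verts_def)
  ultimately show ?thesis by (auto simp: simple_graph_def)
qed

lemma position_diff:
  "position n (x, y, z) - position n (x', y', z') =
     int n * (x - x') + 2 * (int n)\<^sup>2 * (y - y') + (2 * (int n)\<^sup>2 + 1) * (z - z')"
  by (simp add: position_def algebra_simps)

text \<open>The sum of the three positive side lengths exceeds each of them, which gives the strict
  bounds that \<open>position_difference\<close> asks for.\<close>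

lemma position_eq_iff:
  assumes "u \<in> grid3_verts n1 n2 n3" "v \<in> grid3_verts n1 n2 n3" "n = n1 + n2 + n3"
  shows "position n u = position n v \<longleftrightarrow> u = v"
proof -
  obtain x y z x' y' z' where uv: "u = (x, y, z)" "v = (x', y', z')" by (cases u; cases v)
  have "position n u - position n v = 0 \<longleftrightarrow> x - x' = 0 \<and> y - y' = 0 \<and> z - z' = 0"
    unfolding uv position_diff using assms
    by (intro position_difference(1)) (auto simp: uv grid3_verts_def)
  then show ?thesis by (auto simp: uv)
qed

lemma grid3_adj_iff_position:
  assumes "u \<in> grid3_verts n1 n2 n3" "v \<in> grid3_verts n1 n2 n3" "n = n1 + n2 + n3"
  shows "grid3_adj u v \<longleftrightarrow>
    \<bar>position n u - position n v\<bar> \<in> {int n, 2 * (int n)\<^sup>2, 2 * (int n)\<^sup>2 + 1}"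
proof -
  obtain x y z x' y' z' where uv: "u = (x, y, z)" "v = (x', y', z')" by (cases u; cases v)
  have b: "\<bar>x - x'\<bar> + 1 < int n" "\<bar>y - y'\<bar> + 1 < int n" "\<bar>z - z'\<bar> + 1 < int n"
    "\<bar>x' - x\<bar> + 1 < int n" "\<bar>y' - y\<bar> + 1 < int n" "\<bar>z' - z\<bar> + 1 < int n"
    using assms by (auto simp: uv grid3_verts_def)
  note forward = position_difference(2-4)[OF b(1-3), folded position_diff]
  note backward = position_difference(2-4)[OF b(4-6), folded position_diff]
  \<comment> \<open>\<open>position_difference\<close> is about signed differences, so the absolute
    value is split into the two orders of the endpoints.\<close>
  have eq: "\<bar>position n u - position n v\<bar> = c \<longleftrightarrow>
      position n (x, y, z) - position n (x', y', z') = c \<or>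
      position n (x', y', z') - position n (x, y, z) = c" if "0 \<le> c" for c
    using that unfolding uv by linarith
  have one: "\<bar>r - s\<bar> = 1 \<longleftrightarrow> r - s = 1 \<or> s - r = 1" for r s :: int by linarith
  have "\<bar>position n u - position n v\<bar> \<in> {int n, 2 * (int n)\<^sup>2, 2 * (int n)\<^sup>2 + 1} \<longleftrightarrow>
      (x - x' = 1 \<and> y - y' = 0 \<and> z - z' = 0 \<or> x' - x = 1 \<and> y' - y = 0 \<and> z' - z = 0) \<or>
      (x - x' = 0 \<and> y - y' = 1 \<and> z - z' = 0 \<or> x' - x = 0 \<and> y' - y = 1 \<and> z' - z = 0) \<or>
      (x - x' = 0 \<and> y - y' = 0 \<and> z - z' = 1 \<or> x' - x = 0 \<and> y' - y = 0 \<and> z' - z = 1)"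
    using eq[of "int n"] eq[of "2 * (int n)\<^sup>2"] eq[of "2 * (int n)\<^sup>2 + 1"]
    unfolding forward backward by simp
  also have "\<dots> \<longleftrightarrow> grid3_adj u v" unfolding uv grid3_adj.simps one by auto
  finally show ?thesis by simp
qed

section \<open>Realising a grid by a comb\<close>

lemma grid3_2_interval_PCG:
  assumes n: "1 \<le> n1" "1 \<le> n2" "1 \<le> n3"
  shows "interval_PCG 2 (grid3 n1 n2 n3)"
proof (cases "n1 = 1 \<and> n2 = 1 \<and> n3 = 1")
  case True
  then have verts: "pverts (grid3 n1 n2 n3) = {(0, 0, 0)}"
    by (auto simp: grid3_def grid3_verts_def)
  \<comment> \<open>One position with a hanging leaf would give an edge with two leaves, so a single
    grid vertex is represented by the one-vertex tree. The intervals are the points 0 and 1.\<close>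
  have leaf: "leaves (comb 0 {}) = {0}" by (auto simp: leaves_def comb_def)
  have "weighted_tree (comb 0 {}) (\<lambda>_. 1)" by (rule comb_weighted_tree) simp
  moreover have "bij_betw (\<lambda>_. 0) (pverts (grid3 n1 n2 n3)) (leaves (comb 0 {}))"
    unfolding verts leaf by (simp add: bij_betw_def)
  moreover have "disjoint_family_on (\<lambda>j. {real j..real j}) {..<2}"
    by (auto simp: disjoint_family_on_def)
  ultimately show ?thesis
    unfolding interval_PCG_def using grid3_simple_graph[OF n]
    by (intro conjI exI[of _ "comb 0 {}"] exI[of _ "\<lambda>_. 1"] exI[of _ "\<lambda>_. 0"] exI[of _ real])
      (auto simp: verts)
next
  case False
  define k where "k = n1 + n2 + n3"
  let ?V = "grid3_verts n1 n2 n3"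
  define pos where "pos u = nat (position k u)" for u
  define S where "S = pos ` ?V"
  \<comment> \<open>The corner opposite to the origin has the largest position, so the spine ends
    exactly at the two extreme positions and both ends carry a leaf.\<close>
  define m where "m = pos (int n1 - 1, int n2 - 1, int n3 - 1)"
  have nonneg: "0 \<le> position k u" if "u \<in> ?V" for u
    using that by (auto simp: position_def grid3_verts_def)
  have top: "(int n1 - 1, int n2 - 1, int n3 - 1) \<in> ?V" and zero: "(0, 0, 0) \<in> ?V"
    using n by (auto simp: grid3_verts_def)
  have "pos u \<le> m" if "u \<in> ?V" for u
    using that unfolding pos_def m_def
    by (intro nat_mono) (auto simp: position_def grid3_verts_def intro!: add_mono mult_left_mono)
  then have Sm: "S \<subseteq> {..m}" by (auto simp: S_def)
  have S0: "0 \<in> S" using zero by (auto simp: S_def pos_def position_def intro!: image_eqI[of _ _ "(0, 0, 0)"])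
  have mS: "m \<in> S" using top by (auto simp: S_def m_def)
  have "position k (int n1 - 1, int n2 - 1, int n3 - 1) \<noteq> position k (0, 0, 0)"
    using position_eq_iff[OF top zero k_def] False n by auto
  then have "0 < m" using nonneg[OF top] by (auto simp: m_def pos_def position_def)
  have pos_real: "real (pos u) = real_of_int (position k u)" if "u \<in> ?V" for u
    using nonneg[OF that] by (simp add: pos_def)
  have inj: "inj_on pos ?V"
  proof (rule inj_onI)
    fix u v assume "u \<in> ?V" "v \<in> ?V" "pos u = pos v"
    then show "u = v" using position_eq_iff[OF _ _ k_def] nonneg by (metis pos_def nat_eq_iff)
  qed
  define \<zeta> where "\<zeta> u = 2 * pos u + 1" for u
  have "bij_betw \<zeta> (pverts (grid3 n1 n2 n3)) (leaves (comb m S))"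
  proof -
    have "inj_on \<zeta> ?V" using inj by (auto simp: inj_on_def \<zeta>_def)
    moreover have "leaves (comb m S) = \<zeta> ` ?V"
      using comb_leaves[OF Sm S0 mS \<open>0 < m\<close>] by (auto simp: S_def \<zeta>_def)
    ultimately show ?thesis by (simp add: bij_betw_def grid3_def)
  qed
  \<comment> \<open>The step lengths \<open>k\<close>, \<open>2 * k\<^sup>2\<close> and
    \<open>2 * k\<^sup>2 + 1\<close> are raised by 2 for the two hanging edges; the first interval
    is a point, the second has length 1.\<close>
  moreover define a b :: "nat \<Rightarrow> real"
    where "a j = (if j = 0 then real k + 2 else 2 * (real k)\<^sup>2 + 2)"
      and "b j = (if j = 0 then real k + 2 else 2 * (real k)\<^sup>2 + 3)" for j
  have two: "{..<2} = {0, 1 :: nat}" by auto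
  have "disjoint_family_on (\<lambda>j. {a j..b j}) {..<2}"
  proof -
    have "1 \<le> real k" using n by (simp add: k_def)
    then have "real k \<le> (real k)\<^sup>2" "0 < (real k)\<^sup>2" using self_le_power[of "real k" 2] by auto
    then have "real k < 2 * (real k)\<^sup>2" by linarith
    then show ?thesis by (auto simp: disjoint_family_on_def two a_def b_def)
  qed
  moreover have "(u, v) \<in> parcs (grid3 n1 n2 n3) \<longleftrightarrow>
      tree_dist (comb m S) (\<lambda>_. 1) (\<zeta> u) (\<zeta> v) \<in> (\<Union>j<2. {a j..b j})"
    if uv: "u \<in> pverts (grid3 n1 n2 n3)" "v \<in> pverts (grid3 n1 n2 n3)" "u \<noteq> v" for u v
  proof -
    have V: "u \<in> ?V" "v \<in> ?V" using uv by (simp_all add: grid3_def)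
    have "pos u \<noteq> pos v" using inj V uv(3) by (auto dest: inj_onD)
    define r where "r = \<bar>position k u - position k v\<bar>"
    have "tree_dist (comb m S) (\<lambda>_. 1) (\<zeta> u) (\<zeta> v) = \<bar>real (pos u) - real (pos v)\<bar> + 2"
      unfolding \<zeta>_def using V \<open>pos u \<noteq> pos v\<close> by (intro comb_tree_dist[OF Sm]) (auto simp: S_def)
    also have "\<dots> = real_of_int r + 2" using V by (simp add: pos_real r_def)
    finally have d: "tree_dist (comb m S) (\<lambda>_. 1) (\<zeta> u) (\<zeta> v) = real_of_int r + 2" .
    have "real_of_int r + 2 \<in> (\<Union>j<2. {a j..b j}) \<longleftrightarrow>
        real_of_int r = real_of_int (int k) \<or>
        real_of_int (2 * (int k)\<^sup>2) \<le> real_of_int r \<and> real_of_int r \<le> real_of_int (2 * (int k)\<^sup>2 + 1)"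
      by (auto simp: two a_def b_def)
    \<comment> \<open>Since \<open>r\<close> is an integer, the interval of length 1 admits only its
      two endpoints.\<close>
    also have "\<dots> \<longleftrightarrow> r \<in> {int k, 2 * (int k)\<^sup>2, 2 * (int k)\<^sup>2 + 1}"
      unfolding of_int_eq_iff of_int_le_iff by auto
    also have "\<dots> \<longleftrightarrow> (u, v) \<in> parcs (grid3 n1 n2 n3)"
      using grid3_adj_iff_position[OF V k_def] V by (simp add: grid3_def r_def)
    finally show ?thesis unfolding d by simp
  qed
  moreover have "\<forall>j<2. a j \<le> b j" by (simp add: a_def b_def)
  ultimately show ?thesis
    unfolding interval_PCG_def using grid3_simple_graph[OF n] comb_weighted_tree[OF Sm] by blast
qed

theorem corollary5p3:
  shows "2 \<in> {k. 1 \<le> k \<and> all_grid3_interval_PCG k} \<and>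
         (\<forall>k \<in> {k. 1 \<le> k \<and> all_grid3_interval_PCG k}. 2 \<le> k)"
proof (intro conjI ballI)
  show "2 \<in> {k. 1 \<le> k \<and> all_grid3_interval_PCG k}"
    using grid3_2_interval_PCG by (simp add: all_grid3_interval_PCG_def)
next
  fix k assume k: "k \<in> {k. 1 \<le> k \<and> all_grid3_interval_PCG k}"
  have "interval_PCG k (grid3 3 3 3)" using k by (simp add: all_grid3_interval_PCG_def)
  then have "k \<noteq> 1" using grid3_3_3_3_not_PCG by blast
  then show "2 \<le> k" using k by simp
qed

end
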